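(* Fix the strongly connected directed graph $G=(V,E)$, the functions $\{f_i\}_{i\in V}$, the partition $V=V_1\cup V_2$, the vectors $\bar x_i\in\mathbb{R}^m$ ($i\in V$), the constants $\sigma,s_{\min},s_{\max}>0$, and an integer $K>0$. Suppose that for every $i\in V$ the conjugate $f_i^*$ is strongly convex with modulus $\sigma$ (equivalently, $\nabla f_i$ is Lipschitz continuous with constant $1/\sigma$). Then there is some $\gamma_5\in(0,1)$ such that the following holds. Let $(\mathbf{z}^k,\mathbf{x}^k,\mathbf{s}^k)$ and $\{f_i^k\}_{i\in V_2}$, $k=0,1,\dots,K$, be consecutive iterates of the algorithm described in the context (the iterate relabelled as $k=0$ may be any iterate of a run of the algorithm). Suppose that: (1) for each $k$, $\sum_{\alpha\in V\cup E}s_\alpha^k=|V|$, $s_\alpha^k>0$ for all $\alpha\in V$, and $s_\alpha^k\ge 0$ for all $\alpha\in E$; (2) for each $k$ and all $\alpha\in V\cup E$, if $s_\alpha^k>0$ then $s_{\min}\le s_\alpha^k\le s_{\max}$; (3) the iterate $k=1$ is obtained from the iterate $k=0$ by carrying out Operation C once on every node $i\in V$ and no other operation (so $\mathbf{s}^1=\mathbf{s}^0$); (4) for every edge $(i,j)\in E$ there is some $\bar k\in\{1,\dots,K-1\}$ such that, in passing from iterate $\bar k$ to iterate $\bar k+1$, Operation A is conducted on node $i$ followed by Operation B on edge $(i,j)$. Then $$\tilde F_S^K(\mathbf{z}^K,\mathbf{s}^K)-F_S^*\le\gamma_5\big[\tilde F_S^0(\mathbf{z}^0,\mathbf{s}^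0)-F_S^*\big].$$
   Context: **Setting.** $G=(V,E)$ is a finite strongly connected directed graph; $\deg_{\rm out}(i)$ is the number of out-neighbours of $i\in V$. For each $i\in V$, $f_i$ is a closed convex function on $\mathbb{R}^m$ and $\bar x_i\in\mathbb{R}^m$; $\bar m=\frac1{|V|}\sum_{i\in V}\bar x_i$. The underlying problem is $\min_{x\in\mathbb{R}^m}\sum_{i\in V}[f_i(x)+\frac12\|x-\bar x_i\|^2]$. $V=V_1\cup V_2$ is a disjoint union; functions with index in $V_1$ are treated by proximal steps, and those with index in $V_2$ (which have domain $\mathbb{R}^m$) by affine minorants. $g^*$ denotes the Fenchel conjugate of $g$. **Algorithm.** The state consists of $y_\alpha\in\mathbb{R}^m$ and $s_\alpha\in\mathbb{R}$ for $\alpha\in V\cup E$, $\sigma_{i,y}\in\mathbb{R}^m$ and $\sigma_{i,s}\in\mathbb{R}$ for $i\in V$, $\rho_{(i,j),y}\in\mathbb{R}^m$ and $\rho_{(i,j),s}\in\mathbb{R}$ for $(i,j)\in E$, vectors $z_i=[\mathbf{z}_i]_i\in\mathbb{R}^m$ for $i\in V$, and affine functions $f_i^k\le f_i$ for $i\in V_2$. At all times $y_{(i,j)}=\sigma_{i,y}-\rho_{(i,j),y}$ and $s_{(i,j)}=\sigma_{i,s}-\rho_{(i,j),s}$ for $(i,j)\in E$, and $x_\alpha=y_\alpha/s_\alpha$ whenever $s_\alpha>0$, with the convention $x_{(i,j)}=x_i$ if $s_{(i,j)}=0$. Initialization: $y_i^0$ ($i\in V$) are such that $\frac1{|V|}\sum_{i\in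 V}y_i^0=\bar m$; $y_\alpha^0=0$ and $s_\alpha^0=0$ for $\alpha\in E$; $s_i^0=1$ for $i\in V$; all $\sigma$'s and $\rho$'s are $0$; $z_i^0=0$ for $i\in V_1$; for $i\in V_2$, $f_i^0\le f_i$ is affine with gradient $z_i^0$, and then $y_i^0$ is replaced by $y_i^0-z_i^0$. Iteration $k$ ($k\ge1$): starting from the data of iteration $k-1$, perform Operations A, B and/or C below (in one iteration, A and C may be carried out for several nodes and B for several edges, at most once for each node, respectively edge). Data that are not mentioned are carried over. Operation A on node $i$: $y_i\leftarrow y_i/(\deg_{\rm out}(i)+1)$ and $s_i\leftarrow s_i/(\deg_{\rm out}(i)+1)$; then $\sigma_{i,y}\leftarrow\sigma_{i,y}+y_i$ and $\sigma_{i,s}\leftarrow\sigma_{i,s}+s_i$ (with the new $y_i,s_i$). Operation B on edge $(i,j)$: $y_j\leftarrow y_j+\sigma_{i,y}-\rho_{(i,j),y}$ and $s_j\leftarrow s_j+\sigma_{i,s}-\rho_{(i,j),s}$; then $\rho_{(i,j),y}\leftarrow\sigma_{i,y}$ and $\rho_{(i,j),s}\leftarrow\sigma_{i,s}$. Operation C on node $j$: let $x_{\rm temp}=\frac1{s_j}(y_j+z_j)$. - If $j\in V_1$: $x_j^{\rm new}=\arg\min_x\ \frac{s_j}2\|x_{\rm temp}-x\|^2+f_j(x)$ and $z_j^{\rm new}=s_j(x_{\rm temp}-x_j^{\rm new})$. - If $j\in V_2$: let $g_j\le f_j$ be the current affine minorant, $x_j=y_j/s_j$ the current value, $v_j\in\partial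 f_j(x_j)$, $\tilde g_j(x)=v_j^T(x-x_j)+f_j(x_j)$; then $x_j^{\rm new}=\arg\min_x\big[\max\{g_j,\tilde g_j\}(x)+\frac{s_j}2\|x-x_{\rm temp}\|^2\big]$, $z_j^{\rm new}=s_j(x_{\rm temp}-x_j^{\rm new})$, and the new affine minorant is $x\mapsto (z_j^{\rm new})^T(x-x_j^{\rm new})+\max\{g_j,\tilde g_j\}(x_j^{\rm new})$. In both cases set $y_j\leftarrow s_jx_j^{\rm new}$; $s_j$ is unchanged. **Objective values.** The iterates after iteration $k$ are denoted $\mathbf{z}^k,\mathbf{x}^k=\{x_\alpha^k\}_{\alpha\in V\cup E},\mathbf{s}^k=\{s_\alpha^k\}_{\alpha\in V\cup E}$, with affine minorants $f_i^k$, $i\in V_2$. Define $$\tilde F_S^k(\mathbf{z}^k,\mathbf{s}^k)=\sum_{i\in V_1}f_i^*(z_i^k)+\sum_{i\in V_2}[f_i^k]^*(z_i^k)+\sum_{\alpha\in V\cup E}\frac{s_\alpha^k}2\|x_\alpha^k\|^2\in\mathbb{R}\cup\{\infty\}.$$ $F_S^*$ is the (finite) optimal value of the dual problem of minimizing $$F_S(\mathbf{z},\mathbf{s}^0)=\sum_{i\in V}\mathbf{f}_i^*(\mathbf{z}_i)+\sum_{\beta\in F}\delta_{H_\beta^\perp}(\mathbf{z}_\beta)+\sum_{\alpha\in V\cup E}\frac{s_\alpha^0}2\Big\|\bar m-\frac1{s_\alpha^0}\Big[\sum_{\alpha_2\in V\cup F}\mathbf{z}_{\alpha_2}\Big]_\alpha\Big\|^2$$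 over all $\mathbf{z}=\{\mathbf{z}_\alpha\}_{\alpha\in V\cup F}$ with $\mathbf{z}_\alpha\in[\mathbb{R}^m]^{|V\cup E|}$, where $[\cdot]_\alpha$ is the $\alpha$-component, $\mathbf{f}_i(\mathbf{x})=f_i([\mathbf{x}]_i)$, $F=\{\{i,(i,j)\}:(i,j)\in E\}\cup\{\{i,j\}:(i,j)\in E\}$, $H_{\{\alpha_1,\alpha_2\}}=\{\mathbf{x}\in[\mathbb{R}^m]^{|V\cup E|}:[\mathbf{x}]_{\alpha_1}=[\mathbf{x}]_{\alpha_2}\}$, $H_\beta^\perp$ is the orthogonal complement of $H_\beta$, and $\delta_S$ is the $\{0,\infty\}$-valued indicator function of $S$. If $s_\alpha^0=0$, the corresponding quadratic term is read as $0$ when $[\sum_{\alpha_2}\mathbf{z}_{\alpha_2}]_\alpha=0$ and $+\infty$ otherwise. *)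

theory Defs
  imports "HOL-Analysis.Analysis" "Graph_Theory.Graph_Theory"
begin

section \<open>Extended-valued convex functions\<close>

definition epigraph_of :: "('a \<Rightarrow> ereal) \<Rightarrow> ('a \<times> real) set" where
  "epigraph_of f = {(x, r). f x \<le> ereal r}"

definition proper_closed_convex :: "('a::euclidean_space \<Rightarrow> ereal) \<Rightarrow> bool" where
  "proper_closed_convex f \<longleftrightarrow>
     (\<forall>x. f x \<noteq> -\<infinity>) \<and> (\<exists>x. f x \<noteq> \<infinity>) \<and> convex (epigraph_of f) \<and> closed (epigraph_of f)"

definition conjugate :: "('a::real_inner \<Rightarrow> ereal) \<Rightarrow> 'a \<Rightarrow> ereal" where
  "conjugate f z = (SUP x. ereal (x \<bullet> z) - f x)"

definition strongly_convex :: "real \<Rightarrow> ('a::real_normed_vector \<Rightarrow> ereal) \<Rightarrow> bool" where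
  "strongly_convex \<sigma> f \<longleftrightarrow>
     (\<forall>u v t. 0 < t \<and> t < 1 \<longrightarrow>
        f ((1 - t) *\<^sub>R u + t *\<^sub>R v) + ereal (\<sigma> / 2 * t * (1 - t) * (norm (u - v))\<^sup>2)
          \<le> ereal (1 - t) * f u + ereal t * f v)"

definition subdifferential :: "('a::real_inner \<Rightarrow> ereal) \<Rightarrow> 'a \<Rightarrow> 'a set" where
  "subdifferential f x = {v. \<forall>y. f x + ereal (v \<bullet> (y - x)) \<le> f y}"

definition set_indicator :: "'a set \<Rightarrow> 'a \<Rightarrow> ereal" where
  "set_indicator S x = (if x \<in> S then 0 else \<infinity>)"


section \<open>The dual problem\<close>

text \<open>The index set \<open>V \<union> E\<close> is a disjoint union, encoded by two constructors.\<close>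

datatype 'v comp = Node 'v | Edge "'v \<times> 'v"

definition comps :: "'v pair_pre_digraph \<Rightarrow> 'v comp set" where
  "comps G = Node ` pverts G \<union> Edge ` parcs G"

text \<open>The product space \<open>[R^m]^(|V \<union> E|)\<close>, as extensional functions on \<open>V \<union> E\<close>.\<close>

definition prod_space :: "'v pair_pre_digraph \<Rightarrow> ('v comp \<Rightarrow> real^'m) set" where
  "prod_space G = comps G \<rightarrow>\<^sub>E UNIV"

definition prod_inner ::
  "'v pair_pre_digraph \<Rightarrow> ('v comp \<Rightarrow> real^'m) \<Rightarrow> ('v comp \<Rightarrow> real^'m) \<Rightarrow> real" where
  "prod_inner G x z = (\<Sum>\<alpha>\<in>comps G. x \<alpha> \<bullet> z \<alpha>)"

definition prod_conjugate ::
  "'v pair_pre_digraph \<Rightarrow> (('v comp \<Rightarrow> real^'m) \<Rightarrow> ereal) \<Rightarrow> ('v comp \<Rightarrow> real^'m) \<Rightarrow> ereal" where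
  "prod_conjugate G h z = (SUP x\<in>prod_space G. ereal (prod_inner G x z) - h x)"

definition couplings :: "'v pair_pre_digraph \<Rightarrow> 'v comp set set" where
  "couplings G = (\<lambda>(i, j). {Node i, Edge (i, j)}) ` parcs G \<union> (\<lambda>(i, j). {Node i, Node j}) ` parcs G"

definition coupling_space :: "'v pair_pre_digraph \<Rightarrow> 'v comp set \<Rightarrow> ('v comp \<Rightarrow> real^'m) set" where
  "coupling_space G \<beta> = {x \<in> prod_space G. \<forall>\<alpha>\<^sub>1\<in>\<beta>. \<forall>\<alpha>\<^sub>2\<in>\<beta>. x \<alpha>\<^sub>1 = x \<alpha>\<^sub>2}"

definition prod_orthogonal ::
  "'v pair_pre_digraph \<Rightarrow> ('v comp \<Rightarrow> real^'m) set \<Rightarrow> ('v comp \<Rightarrow> real^'m) set" where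
  "prod_orthogonal G H = {z \<in> prod_space G. \<forall>x\<in>H. prod_inner G x z = 0}"

text \<open>The index set \<open>V \<union> F\<close> of the blocks of a dual variable.\<close>

datatype 'v block = FunBlock 'v | CouplingBlock "'v comp set"

definition blocks :: "'v pair_pre_digraph \<Rightarrow> 'v block set" where
  "blocks G = FunBlock ` pverts G \<union> CouplingBlock ` couplings G"

definition mean_vec :: "'v pair_pre_digraph \<Rightarrow> ('v \<Rightarrow> real^'m) \<Rightarrow> real^'m" where
  "mean_vec G y = (1 / real (card (pverts G))) *\<^sub>R (\<Sum>i\<in>pverts G. y i)"

definition quad_term :: "real \<Rightarrow> 'a::real_inner \<Rightarrow> 'a \<Rightarrow> ereal" where
  "quad_term s c w =
     (if s = 0 then (if w = 0 then 0 else \<infinity>) else ereal (s / 2 * (norm (c - (1 / s) *\<^sub>R w))\<^sup>2))"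

definition dual_objective ::
  "'v pair_pre_digraph \<Rightarrow> ('v \<Rightarrow> real^'m \<Rightarrow> ereal) \<Rightarrow> ('v \<Rightarrow> real^'m) \<Rightarrow> ('v comp \<Rightarrow> real)
     \<Rightarrow> ('v block \<Rightarrow> 'v comp \<Rightarrow> real^'m) \<Rightarrow> ereal" where
  "dual_objective G f xbar s z =
     (\<Sum>i\<in>pverts G. prod_conjugate G (\<lambda>x. f i (x (Node i))) (z (FunBlock i)))
     + (\<Sum>\<beta>\<in>couplings G.
          set_indicator (prod_orthogonal G (coupling_space G \<beta>)) (z (CouplingBlock \<beta>)))
     + (\<Sum>\<alpha>\<in>comps G. quad_term (s \<alpha>) (mean_vec G xbar) (\<Sum>b\<in>blocks G. z b \<alpha>))"

fun initial_mass :: "'v comp \<Rightarrow> real" where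
  "initial_mass (Node i) = 1"
| "initial_mass (Edge e) = 0"

definition dual_opt ::
  "'v pair_pre_digraph \<Rightarrow> ('v \<Rightarrow> real^'m \<Rightarrow> ereal) \<Rightarrow> ('v \<Rightarrow> real^'m) \<Rightarrow> ereal" where
  "dual_opt G f xbar =
     (INF z\<in>blocks G \<rightarrow>\<^sub>E prod_space G. dual_objective G f xbar initial_mass z)"


section \<open>The algorithm\<close>

text \<open>
  The edge quantities \<open>y\<^sub>(\<^sub>i\<^sub>,\<^sub>j\<^sub>)\<close> and \<open>s\<^sub>(\<^sub>i\<^sub>,\<^sub>j\<^sub>)\<close> always equal \<open>\<sigma>\<^sub>i - \<rho>\<^sub>(\<^sub>i\<^sub>,\<^sub>j\<^sub>)\<close>, so they are derived
  from the state (by \<open>y_of\<close> and \<open>s_of\<close> below) instead of being stored in it.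
  The field \<open>minorant\<close> is meaningful on \<open>V\<^sub>2\<close> only.
\<close>

record ('v, 'm) state =
  ynode :: "'v \<Rightarrow> real^'m"
  snode :: "'v \<Rightarrow> real"
  sig_y :: "'v \<Rightarrow> real^'m"
  sig_s :: "'v \<Rightarrow> real"
  rho_y :: "'v \<times> 'v \<Rightarrow> real^'m"
  rho_s :: "'v \<times> 'v \<Rightarrow> real"
  zvec :: "'v \<Rightarrow> real^'m"
  minorant :: "'v \<Rightarrow> real^'m \<Rightarrow> real"

fun y_of :: "('v, 'm::finite) state \<Rightarrow> 'v comp \<Rightarrow> real^'m" where
  "y_of S (Node i) = ynode S i"
| "y_of S (Edge (i, j)) = sig_y S i - rho_y S (i, j)"

fun s_of :: "('v, 'm::finite) state \<Rightarrow> 'v comp \<Rightarrow> real" where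
  "s_of S (Node i) = snode S i"
| "s_of S (Edge (i, j)) = sig_s S i - rho_s S (i, j)"

fun x_of :: "('v, 'm::finite) state \<Rightarrow> 'v comp \<Rightarrow> real^'m" where
  "x_of S (Node i) = (1 / s_of S (Node i)) *\<^sub>R y_of S (Node i)"
| "x_of S (Edge (i, j)) =
     (if s_of S (Edge (i, j)) = 0 then x_of S (Node i)
      else (1 / s_of S (Edge (i, j))) *\<^sub>R y_of S (Edge (i, j)))"

definition initial_state ::
  "'v pair_pre_digraph \<Rightarrow> ('v \<Rightarrow> real^'m \<Rightarrow> ereal) \<Rightarrow> 'v set \<Rightarrow> 'v set \<Rightarrow> ('v \<Rightarrow> real^'m)
     \<Rightarrow> ('v, 'm::finite) state \<Rightarrow> bool" where
  "initial_state G f V1 V2 xbar S \<longleftrightarrow>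
     (\<exists>y0. mean_vec G y0 = mean_vec G xbar \<and>
        (\<forall>i\<in>V1. ynode S i = y0 i) \<and> (\<forall>i\<in>V2. ynode S i = y0 i - zvec S i)) \<and>
     (\<forall>i\<in>pverts G. snode S i = 1 \<and> sig_y S i = 0 \<and> sig_s S i = 0) \<and>
     (\<forall>e\<in>parcs G. rho_y S e = 0 \<and> rho_s S e = 0) \<and>
     (\<forall>i\<in>V1. zvec S i = 0) \<and>
     (\<forall>i\<in>V2. (\<exists>b. minorant S i = (\<lambda>x. zvec S i \<bullet> x + b)) \<and>
              (\<forall>x. ereal (minorant S i x) \<le> f i x))"

datatype 'v operation = OpA 'v | OpB "'v \<times> 'v" | OpC 'v

definition operations :: "'v pair_pre_digraph \<Rightarrow> 'v operation set" where
  "operations G = OpA ` pverts G \<union> OpB ` parcs G \<union> OpC ` pverts G"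

definition do_A :: "'v pair_pre_digraph \<Rightarrow> 'v \<Rightarrow> ('v, 'm::finite) state \<Rightarrow> ('v, 'm) state" where
  "do_A G i S =
     (let d = real (out_degree (with_proj G) i) + 1;
          y = (1 / d) *\<^sub>R ynode S i;
          s = snode S i / d
      in S\<lparr>ynode := (ynode S)(i := y), snode := (snode S)(i := s),
           sig_y := (sig_y S)(i := sig_y S i + y), sig_s := (sig_s S)(i := sig_s S i + s)\<rparr>)"

definition do_B :: "'v \<Rightarrow> 'v \<Rightarrow> ('v, 'm::finite) state \<Rightarrow> ('v, 'm) state" where
  "do_B i j S =
     S\<lparr>ynode := (ynode S)(j := ynode S j + sig_y S i - rho_y S (i, j)),
       snode := (snode S)(j := snode S j + sig_s S i - rho_s S (i, j)),
       rho_y := (rho_y S)((i, j) := sig_y S i),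
       rho_s := (rho_s S)((i, j) := sig_s S i)\<rparr>"

definition x_temp :: "('v, 'm::finite) state \<Rightarrow> 'v \<Rightarrow> real^'m" where
  "x_temp S j = (1 / snode S j) *\<^sub>R (ynode S j + zvec S j)"

text \<open>The choices in Operation C (of the minimizer and, on \<open>V\<^sub>2\<close>, of the subgradient) make it a
  relation between states.\<close>

definition step_C1 ::
  "('v \<Rightarrow> real^'m \<Rightarrow> ereal) \<Rightarrow> 'v \<Rightarrow> ('v, 'm::finite) state \<Rightarrow> ('v, 'm) state \<Rightarrow> bool" where
  "step_C1 f j S S' \<longleftrightarrow>
     (\<exists>xnew.
        is_arg_min (\<lambda>x. ereal (snode S j / 2 * (norm (x_temp S j - x))\<^sup>2) + f j x) (\<lambda>_. True) xnew \<and>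
        S' = S\<lparr>ynode := (ynode S)(j := snode S j *\<^sub>R xnew),
               zvec := (zvec S)(j := snode S j *\<^sub>R (x_temp S j - xnew))\<rparr>)"

definition step_C2 ::
  "('v \<Rightarrow> real^'m \<Rightarrow> ereal) \<Rightarrow> 'v \<Rightarrow> ('v, 'm::finite) state \<Rightarrow> ('v, 'm) state \<Rightarrow> bool" where
  "step_C2 f j S S' \<longleftrightarrow>
     (\<exists>v xnew.
        let xj = x_of S (Node j);
            gtilde = (\<lambda>x. v \<bullet> (x - xj) + real_of_ereal (f j xj));
            gmax = (\<lambda>x. max (minorant S j x) (gtilde x));
            znew = snode S j *\<^sub>R (x_temp S j - xnew)
        in v \<in> subdifferential (f j) xj \<and>
           is_arg_min (\<lambda>x. gmax x + snode S j / 2 * (norm (x - x_temp S j))\<^sup>2) (\<lambda>_. True) xnew \<and>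
           S' = S\<lparr>ynode := (ynode S)(j := snode S j *\<^sub>R xnew),
                  zvec := (zvec S)(j := znew),
                  minorant := (minorant S)(j := (\<lambda>x. znew \<bullet> (x - xnew) + gmax xnew))\<rparr>)"

fun perform ::
  "'v pair_pre_digraph \<Rightarrow> ('v \<Rightarrow> real^'m \<Rightarrow> ereal) \<Rightarrow> 'v set \<Rightarrow> 'v operation
     \<Rightarrow> ('v, 'm::finite) state \<Rightarrow> ('v, 'm) state \<Rightarrow> bool" where
  "perform G f V2 (OpA i) S S' \<longleftrightarrow> S' = do_A G i S"
| "perform G f V2 (OpB (i, j)) S S' \<longleftrightarrow> S' = do_B i j S"
| "perform G f V2 (OpC j) S S' \<longleftrightarrow> (if j \<in> V2 then step_C2 f j S S' else step_C1 f j S S')"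

fun perform_list ::
  "'v pair_pre_digraph \<Rightarrow> ('v \<Rightarrow> real^'m \<Rightarrow> ereal) \<Rightarrow> 'v set \<Rightarrow> 'v operation list
     \<Rightarrow> ('v, 'm::finite) state \<Rightarrow> ('v, 'm) state \<Rightarrow> bool" where
  "perform_list G f V2 [] S S' \<longleftrightarrow> S' = S"
| "perform_list G f V2 (p # ps) S S' \<longleftrightarrow>
     (\<exists>T. perform G f V2 p S T \<and> perform_list G f V2 ps T S')"

text \<open>An iteration carries out the operations of a nonempty list one after the other, in any order;
  distinctness says that A and C are done at most once per node and B at most once per edge.\<close>

definition iteration ::
  "'v pair_pre_digraph \<Rightarrow> ('v \<Rightarrow> real^'m \<Rightarrow> ereal) \<Rightarrow> 'v set \<Rightarrow> 'v operation list
     \<Rightarrow> ('v, 'm::finite) state \<Rightarrow> ('v, 'm) state \<Rightarrow> bool" where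
  "iteration G f V2 ps S S' \<longleftrightarrow>
     ps \<noteq> [] \<and> distinct ps \<and> set ps \<subseteq> operations G \<and> perform_list G f V2 ps S S'"

text \<open>The first \<open>n\<close> iterations of a run; \<open>ops k\<close> lists the operations that lead from \<open>st k\<close> to
  \<open>st (Suc k)\<close>.\<close>

definition algorithm_run ::
  "'v pair_pre_digraph \<Rightarrow> ('v \<Rightarrow> real^'m \<Rightarrow> ereal) \<Rightarrow> 'v set \<Rightarrow> 'v set \<Rightarrow> ('v \<Rightarrow> real^'m) \<Rightarrow> nat
     \<Rightarrow> (nat \<Rightarrow> ('v, 'm::finite) state) \<Rightarrow> (nat \<Rightarrow> 'v operation list) \<Rightarrow> bool" where
  "algorithm_run G f V1 V2 xbar n st ops \<longleftrightarrow>
     initial_state G f V1 V2 xbar (st 0) \<and>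
     (\<forall>k<n. iteration G f V2 (ops k) (st k) (st (Suc k)))"

definition followed_by :: "'a \<Rightarrow> 'a \<Rightarrow> 'a list \<Rightarrow> bool" where
  "followed_by p q ps \<longleftrightarrow> (\<exists>a b. a < b \<and> b < length ps \<and> ps ! a = p \<and> ps ! b = q)"

definition alg_objective ::
  "'v pair_pre_digraph \<Rightarrow> ('v \<Rightarrow> real^'m \<Rightarrow> ereal) \<Rightarrow> 'v set \<Rightarrow> 'v set
     \<Rightarrow> ('v, 'm::finite) state \<Rightarrow> ereal" where
  "alg_objective G f V1 V2 S =
     (\<Sum>i\<in>V1. conjugate (f i) (zvec S i))
     + (\<Sum>i\<in>V2. conjugate (\<lambda>x. ereal (minorant S i x)) (zvec S i))
     + ereal (\<Sum>\<alpha>\<in>comps G. s_of S \<alpha> / 2 * (norm (x_of S \<alpha>))\<^sup>2)"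

end

theory Submission
  imports Defs
begin

text \<open>
  The idea is to compare the decrease of the objective with a duality gap.  Let \<open>n\<close> be the number of
  nodes, \<open>m\<close> the mean of the given vectors, and \<open>P x = (\<Sum>i. f i x) + n/2 |x|^2 - n (m \<bullet> x)\<close>.
  Testing every conjugate in the dual objective with the constant vector \<open>x\<close> shows that the dual
  optimal value is at least \<open>- P x\<close>, for every \<open>x\<close> (\<open>weak_duality\<close>).

  The operations conserve \<open>(\<Sum>\<alpha>. y \<alpha>) + (\<Sum>i. z i) = n m\<close>, and the total mass is \<open>n\<close>, so completing
  squares turns the objective plus \<open>P x\<close> into a sum of Fenchel-Young gaps \<open>\<phi>* (z i) + f i x - z i \<bullet> x\<close>,
  where \<open>\<phi>\<close> is \<open>f i\<close> on \<open>V1\<close> and the current minorant on \<open>V2\<close>, and of weighted squares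
  \<open>s \<alpha> / 2 |x - x \<alpha>|^2\<close> (\<open>duality_gap\<close>).  Strong convexity of the conjugates makes
  each \<open>f i\<close> smooth (\<open>smooth_upper_bound\<close>).  Hence after one sweep of Operation C the Fenchel-Young
  gap at \<open>i\<close> is bounded by the squared displacement of \<open>x i\<close> in the sweep plus \<open>|x - x i|^2\<close>; on
  \<open>V2\<close> this holds because the new minorant lies above the linearization of \<open>f i\<close> at the old point
  (\<open>bundle_gap\<close>).  What remains is to bound the disagreement of the points \<open>x \<alpha>\<close> after the sweep.

  Each operation lowers the objective by at least a constant times the square of every displacement
  that it causes, where the constant depends on a lower bound of the positive masses
  (\<open>perform_small_step\<close>).  If the objective drops by \<open>D\<close> after the sweep, then no component
  moves by more than \<open>\<delta>\<close>, of the order of the square root of \<open>D\<close>, in a single operation.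
  Operation A on \<open>i\<close> makes the edge component agree with \<open>x i\<close> up to \<open>\<delta>\<close>, and Operation B on
  \<open>(i, j)\<close> costs little only if the edge component is \<open>\<delta>\<close>-close to \<open>x j\<close>; so \<open>x i\<close> and \<open>x j\<close> differ
  by at most a multiple of \<open>\<delta>\<close> (\<open>tail_near_head\<close>), and strong connectivity spreads this to all
  nodes (\<open>consensus_constant\<close>).  Altogether the gap before the sweep is at most \<open>c\<close> times the
  decrease over all \<open>K\<close> iterations (\<open>gap_le_decrease\<close>), which is contraction with the factor
  \<open>1 - 1 / (c + 1)\<close>.
\<close>

section \<open>Strongly convex conjugates and proximal steps\<close>

lemma conjugate_ge:
  assumes "f x = ereal r"
  shows "ereal (x \<bullet> z - r) \<le> conjugate f z"
  unfolding conjugate_def by (rule SUP_upper2[of x]) (auto simp: assms)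

lemma conjugate_at_subgradient:
  assumes "f x0 = ereal r" and v: "v \<in> subdifferential f x0"
  shows "conjugate f v = ereal (v \<bullet> x0 - r)"
proof (rule antisym)
  show "conjugate f v \<le> ereal (v \<bullet> x0 - r)"
    unfolding conjugate_def
  proof (rule SUP_least)
    fix x
    have "ereal (r + v \<bullet> (x - x0)) \<le> f x" using v assms(1) by (auto simp: subdifferential_def)
    then show "ereal (x \<bullet> v) - f x \<le> ereal (v \<bullet> x0 - r)"
      by (cases "f x") (auto simp: inner_diff_right inner_commute)
  qed
  show "ereal (v \<bullet> x0 - r) \<le> conjugate f v"
    using conjugate_ge[of f x0 r, OF assms(1), of v] by (simp add: inner_commute)
qed

text \<open>
  The subgradient inequality at \<open>v\<close> with the slope \<open>x0\<close> is improved by the modulus of convexity: apply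
  strong convexity between \<open>v\<close> and \<open>w\<close> and let the weight of \<open>w\<close> tend to zero.
\<close>

lemma conjugate_growth:
  assumes f0: "f x0 = ereal r" and v: "v \<in> subdifferential f x0"
    and sc: "strongly_convex \<sigma> (conjugate f)"
  shows "ereal (w \<bullet> x0 - r + \<sigma> / 2 * (norm (w - v))\<^sup>2) \<le> conjugate f w"
proof -
  have lo: "ereal (u \<bullet> x0 - r) \<le> conjugate f u" for u
    using conjugate_ge[of f x0 r, OF f0, of u] by (simp add: inner_commute)
  show ?thesis
  proof (cases "conjugate f w")
    case (real c)
    have "z * (\<sigma> / 2 * (norm (w - v))\<^sup>2) \<le> c - (w \<bullet> x0 - r)" if z: "0 < z" "z < 1" for z
    proof -
      define t where "t = 1 - z"
      have t: "0 < t" "t < 1" using z by (auto simp: t_def)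
      let ?u = "(1 - t) *\<^sub>R v + t *\<^sub>R w"
      have "ereal (?u \<bullet> x0 - r) + ereal (\<sigma> / 2 * t * (1 - t) * (norm (v - w))\<^sup>2)
          \<le> conjugate f ?u + ereal (\<sigma> / 2 * t * (1 - t) * (norm (v - w))\<^sup>2)"
        by (rule add_right_mono[OF lo])
      also have "\<dots> \<le> ereal (1 - t) * conjugate f v + ereal t * conjugate f w"
        using sc t unfolding strongly_convex_def by blast
      finally have "(?u \<bullet> x0 - r) + \<sigma> / 2 * t * (1 - t) * (norm (v - w))\<^sup>2
          \<le> (1 - t) * (v \<bullet> x0 - r) + t * c"
        by (simp add: conjugate_at_subgradient[OF f0 v] real)
      then have "t * ((w \<bullet> x0 - r) + z * (\<sigma> / 2 * (norm (w - v))\<^sup>2)) \<le> t * c"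
        by (simp add: inner_add_left algebra_simps norm_minus_commute t_def)
      then show ?thesis using t by simp
    qed
    then have "\<sigma> / 2 * (norm (w - v))\<^sup>2 \<le> c - (w \<bullet> x0 - r)"
      by (rule field_le_mult_one_interval)
    then show ?thesis using real by simp
  next
    case PInf then show ?thesis by simp
  next
    case MInf then show ?thesis using lo[of w] by simp
  qed
qed

lemma young:
  fixes a b :: "'a::real_inner"
  assumes "\<sigma> > 0"
  shows "a \<bullet> b \<le> \<sigma> / 2 * (norm a)\<^sup>2 + (norm b)\<^sup>2 / (2 * \<sigma>)"
proof -
  have "0 \<le> (norm (\<sigma> *\<^sub>R a - b))\<^sup>2 / (2 * \<sigma>)" using assms by simp
  also have "(norm (\<sigma> *\<^sub>R a - b))\<^sup>2 = \<sigma>\<^sup>2 * (norm a)\<^sup>2 - 2 * \<sigma> * (a \<bullet> b) + (norm b)\<^sup>2"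
    unfolding power2_norm_eq_inner
    by (simp add: inner_diff_left inner_diff_right inner_commute power2_eq_square algebra_simps)
  also have "\<dots> / (2 * \<sigma>) = \<sigma> / 2 * (norm a)\<^sup>2 - a \<bullet> b + (norm b)\<^sup>2 / (2 * \<sigma>)"
    using assms by (simp add: field_simps power2_eq_square)
  finally show ?thesis by simp
qed

text \<open>
  A point of the epigraph complement is separated from the epigraph.  A non-vertical hyperplane yields
  an affine minorant that violates the quadratic growth of the conjugate.  A vertical hyperplane would
  let the conjugate grow only linearly along a ray, which quadratic growth excludes as well.  The bound
  forces \<open>f\<close> to be finite everywhere.
\<close>

lemma smooth_upper_bound:
  fixes f :: "'a::euclidean_space \<Rightarrow> ereal"
  assumes pcc: "proper_closed_convex f"
    and sc: "strongly_convex \<sigma> (conjugate f)" and \<sigma>: "\<sigma> > 0"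
    and f0: "f x0 = ereal r" and v: "v \<in> subdifferential f x0"
  shows "f x \<le> ereal (r + v \<bullet> (x - x0) + (norm (x - x0))\<^sup>2 / (2 * \<sigma>))" (is "_ \<le> ereal ?B")
proof (rule ccontr)
  assume "\<not> f x \<le> ereal ?B"
  then have "(x, ?B) \<notin> epigraph_of f" by (simp add: epigraph_of_def)
  then obtain ab b where sep: "ab \<bullet> (x, ?B) < b" "\<forall>p\<in>epigraph_of f. ab \<bullet> p > b"
    using separating_hyperplane_closed_point[of "epigraph_of f" "(x, ?B)"] pcc
    unfolding proper_closed_convex_def by blast
  obtain a \<beta> where [simp]: "ab = (a, \<beta>)" by (cases ab)
  have 1: "a \<bullet> x + \<beta> * ?B < b" using sep(1) by simp
  have 2: "a \<bullet> y + \<beta> * \<rho> > b" if "f y \<le> ereal \<rho>" for y \<rho>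
    using sep(2) that by (auto simp: epigraph_of_def)
  have fninf: "f y \<noteq> -\<infinity>" for y using pcc by (auto simp: proper_closed_convex_def)
  note growth = conjugate_growth[OF f0 v sc]
  have \<beta>: "\<beta> \<ge> 0"
  proof (rule ccontr)
    assume neg: "\<not> \<beta> \<ge> 0"
    define \<rho> where "\<rho> = max r ((b - a \<bullet> x0) / \<beta>)"
    have "\<beta> * \<rho> \<le> b - a \<bullet> x0"
      using neg by (auto simp: \<rho>_def max_def field_simps)
    moreover have "a \<bullet> x0 + \<beta> * \<rho> > b" by (rule 2) (simp add: f0 \<rho>_def)
    ultimately show False by simp
  qed
  show False
  proof (cases "\<beta> = 0")
    case True
    have dom: "a \<bullet> y > b" if "f y \<noteq> \<infinity>" for y
      using 2[of y "real_of_ereal (f y)"] that fninf[of y] True by (cases "f y") auto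
    have ax0: "a \<bullet> x0 > b" by (rule dom) (simp add: f0)
    have "a \<noteq> 0" using 1 True ax0 by auto
    then have na: "(norm a)\<^sup>2 > 0" by simp
    \<comment> \<open>a vertical hyperplane: move the dual point \<open>v\<close> along the ray of direction \<open>- a\<close>\<close>
    have lin: "\<sigma> / 2 * t * (norm a)\<^sup>2 \<le> a \<bullet> x0 - b" if t: "t > 0" for t
    proof -
      have "conjugate f (v - t *\<^sub>R a) \<le> ereal (v \<bullet> x0 - r - t * b)"
        unfolding conjugate_def
      proof (rule SUP_least)
        fix y
        show "ereal (y \<bullet> (v - t *\<^sub>R a)) - f y \<le> ereal (v \<bullet> x0 - r - t * b)"
        proof (cases "f y")
          case (real c)
          have "r + v \<bullet> (y - x0) \<le> c" using v f0 real by (auto simp: subdifferential_def dest!: spec[of _ y])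
          moreover have "t * b \<le> t * (a \<bullet> y)" using dom[of y] real t by simp
          ultimately show ?thesis using real
            by (simp add: inner_diff_right inner_commute)
        qed (use fninf in auto)
      qed
      from order_trans[OF growth this]
      have "t * (\<sigma> / 2 * t * (norm a)\<^sup>2) \<le> t * (a \<bullet> x0 - b)"
        by (simp add: inner_diff_left algebra_simps power2_eq_square)
      then show ?thesis using t by simp
    qed
    have "\<sigma> / 2 * (norm a)\<^sup>2 > 0" using \<sigma> na by simp
    moreover define t where "t = (a \<bullet> x0 - b + 1) / (\<sigma> / 2 * (norm a)\<^sup>2)"
    ultimately have "t > 0" "\<sigma> / 2 * t * (norm a)\<^sup>2 = a \<bullet> x0 - b + 1"
      using ax0 by (auto simp: t_def)
    with lin[of t] show False by simp
  next
    case False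
    then have \<beta>: "\<beta> > 0" using \<beta> by simp
    \<comment> \<open>the slope of the separating affine function\<close>
    define w where "w = (- 1 / \<beta>) *\<^sub>R a"
    have "conjugate f w \<le> ereal (- b / \<beta>)"
      unfolding conjugate_def
    proof (rule SUP_least)
      fix y
      show "ereal (y \<bullet> w) - f y \<le> ereal (- b / \<beta>)"
      proof (cases "f y")
        case (real c)
        have "b < a \<bullet> y + \<beta> * c" by (rule 2) (simp add: real)
        then have "b / \<beta> \<le> (a \<bullet> y + \<beta> * c) / \<beta>"
          using \<beta> by (intro divide_right_mono) auto
        then have "y \<bullet> w - c \<le> - b / \<beta>"
          using \<beta> by (simp add: w_def add_divide_distrib inner_commute)
        then show ?thesis using real by simp
      qed (use fninf in auto)
    qed
    from order_trans[OF growth this]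
    have "w \<bullet> x0 - r + \<sigma> / 2 * (norm (w - v))\<^sup>2 \<le> - b / \<beta>" by simp
    also have "- b / \<beta> < w \<bullet> x - ?B"
      using 1 \<beta> by (simp add: w_def field_simps)
    finally have "\<sigma> / 2 * (norm (w - v))\<^sup>2 + (norm (x - x0))\<^sup>2 / (2 * \<sigma>) < (w - v) \<bullet> (x - x0)"
      by (simp add: inner_diff_left inner_diff_right)
    with young[OF \<sigma>, of "w - v" "x - x0"] show False by simp
  qed
qed

text \<open>
  First-order optimality of a proximal step for a possibly nonsmooth convex function: compare the
  minimizer \<open>x0\<close> with points on the segment to \<open>y\<close> and divide by the step length.  Here \<open>a\<close> and \<open>b\<close> are the
  function values at \<open>x0\<close> and \<open>y\<close>.
\<close>

lemma prox_slope:
  fixes c x0 y :: "'a::real_inner"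
  assumes "\<And>t. 0 < t \<Longrightarrow> t < 1 \<Longrightarrow>
      s / 2 * (norm (c - x0))\<^sup>2 + a
        \<le> s / 2 * (norm (c - ((1 - t) *\<^sub>R x0 + t *\<^sub>R y)))\<^sup>2 + ((1 - t) * a + t * b)"
    and "s > 0"
  shows "a + (s *\<^sub>R (c - x0)) \<bullet> (y - x0) \<le> b"
proof -
  let ?q = "s / 2 * (norm (y - x0))\<^sup>2"
  have *: "(s *\<^sub>R (c - x0)) \<bullet> (y - x0) + a - b \<le> t * ?q" if t: "0 < t" "t < 1" for t
  proof -
    have e: "c - ((1 - t) *\<^sub>R x0 + t *\<^sub>R y) = (c - x0) - t *\<^sub>R (y - x0)"
      by (simp add: algebra_simps)
    have "(norm (c - ((1 - t) *\<^sub>R x0 + t *\<^sub>R y)))\<^sup>2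
        = (norm (c - x0))\<^sup>2 - 2 * t * ((c - x0) \<bullet> (y - x0)) + t\<^sup>2 * (norm (y - x0))\<^sup>2"
      unfolding e power2_norm_eq_inner
      by (simp only: inner_diff_left[of "c - x0" "t *\<^sub>R (y - x0)"] inner_diff_right[of _ "c - x0" "t *\<^sub>R (y - x0)"])
        (simp add: inner_commute power2_eq_square algebra_simps)
    moreover have "t * (s * A + a - b) \<le> t * (t * (s / 2 * Q))"
      if "N = M - 2 * t * A + t\<^sup>2 * Q" "s / 2 * M + a \<le> s / 2 * N + ((1 - t) * a + t * b)"
      for M N A Q
      using that(2) unfolding that(1) by (simp add: power2_eq_square algebra_simps)
    ultimately have "t * (s * ((c - x0) \<bullet> (y - x0)) + a - b) \<le> t * (t * ?q)"
      using assms(1)[OF t] by blast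
    then have "t * ((s *\<^sub>R (c - x0)) \<bullet> (y - x0) + a - b) \<le> t * (t * ?q)"
      by simp
    then show ?thesis using t by simp
  qed
  have "(s *\<^sub>R (c - x0)) \<bullet> (y - x0) + a - b \<le> 0"
  proof (rule ccontr)
    let ?p = "(s *\<^sub>R (c - x0)) \<bullet> (y - x0) + a - b"
    assume "\<not> ?p \<le> 0"
    then have p: "?p > 0" by simp
    have q: "?q \<ge> 0" using assms(2) by (intro mult_nonneg_nonneg) auto
    define t where "t = min (1 / 2) (?p / (2 * (?q + 1)))"
    have t: "0 < t" "t < 1" using p q by (auto simp: t_def)
    have "t * ?q \<le> ?p / (2 * (?q + 1)) * ?q" by (rule mult_right_mono) (use q in \<open>simp_all add: t_def\<close>)
    also have "\<dots> = ?p * (?q / (2 * (?q + 1)))" by simp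
    also have "\<dots> < ?p * 1" by (rule mult_strict_left_mono) (use p q in \<open>auto simp: field_simps\<close>)
    finally show False using *[OF t] by simp
  qed
  then show ?thesis by simp
qed

lemma prox_subgradient:
  fixes f :: "'a::euclidean_space \<Rightarrow> ereal"
  assumes pcc: "proper_closed_convex f" and s: "s > 0"
    and am: "is_arg_min (\<lambda>x. ereal (s / 2 * (norm (c - x))\<^sup>2) + f x) (\<lambda>_. True) x0"
  obtains r where "f x0 = ereal r" "s *\<^sub>R (c - x0) \<in> subdifferential f x0"
proof -
  have fninf: "f y \<noteq> -\<infinity>" for y using pcc by (auto simp: proper_closed_convex_def)
  obtain y0 where y0: "f y0 \<noteq> \<infinity>" using pcc by (auto simp: proper_closed_convex_def)
  have min: "ereal (s / 2 * (norm (c - x0))\<^sup>2) + f x0 \<le> ereal (s / 2 * (norm (c - y))\<^sup>2) + f y" for y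
    using am by (auto simp: is_arg_min_def not_less)
  obtain r where r: "f x0 = ereal r"
    using min[of y0] y0 fninf[of x0] fninf[of y0] by (cases "f x0"; cases "f y0") auto
  have "s *\<^sub>R (c - x0) \<in> subdifferential f x0"
    unfolding subdifferential_def
  proof safe
    fix y
    show "f x0 + ereal (s *\<^sub>R (c - x0) \<bullet> (y - x0)) \<le> f y"
    proof (cases "f y")
      case (real b)
      have "r + (s *\<^sub>R (c - x0)) \<bullet> (y - x0) \<le> b"
      proof (rule prox_slope[OF _ s])
        fix t :: real assume t: "0 < t" "t < 1"
        let ?u = "(1 - t) *\<^sub>R x0 + t *\<^sub>R y"
        have "(1 - t) *\<^sub>R (x0, r) + t *\<^sub>R (y, b) \<in> epigraph_of f"
          using pcc t r real unfolding proper_closed_convex_def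
          by (intro convexD) (auto simp: epigraph_of_def)
        then have "f ?u \<le> ereal ((1 - t) * r + t * b)" by (simp add: epigraph_of_def)
        then have "ereal (s / 2 * (norm (c - ?u))\<^sup>2) + f ?u
            \<le> ereal (s / 2 * (norm (c - ?u))\<^sup>2 + ((1 - t) * r + t * b))"
          by (metis add_left_mono plus_ereal.simps(1))
        from order_trans[OF min this]
        show "s / 2 * (norm (c - x0))\<^sup>2 + r \<le> s / 2 * (norm (c - ?u))\<^sup>2 + ((1 - t) * r + t * b)"
          by (simp add: r)
      qed
      then show ?thesis by (simp add: r real)
    qed (use fninf in auto)
  qed
  with r that show ?thesis by blast
qed

lemma prox_max_affine:
  fixes p q :: "'a::real_inner" and a b :: real
  defines "h \<equiv> (\<lambda>x. max (p \<bullet> x + a) (q \<bullet> x + b))"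
  assumes s: "s > 0"
    and am: "is_arg_min (\<lambda>x. h x + s / 2 * (norm (x - c))\<^sup>2) (\<lambda>_. True) x0"
  shows "h x0 + (s *\<^sub>R (c - x0)) \<bullet> (y - x0) \<le> h y"
proof (rule prox_slope[OF _ s])
  fix t :: real assume t: "0 < t" "t < 1"
  let ?u = "(1 - t) *\<^sub>R x0 + t *\<^sub>R y"
  have "h x0 + s / 2 * (norm (c - x0))\<^sup>2 \<le> h ?u + s / 2 * (norm (c - ?u))\<^sup>2"
    using am by (auto simp: is_arg_min_def not_less norm_minus_commute)
  moreover have "h ?u \<le> (1 - t) * h x0 + t * h y"
  proof -
    have 1: "(1 - t) * (p \<bullet> x0 + a) \<le> (1 - t) * h x0" "(1 - t) * (q \<bullet> x0 + b) \<le> (1 - t) * h x0"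
      "t * (p \<bullet> y + a) \<le> t * h y" "t * (q \<bullet> y + b) \<le> t * h y"
      using t by (auto simp: h_def)
    have "p \<bullet> ?u + a = (1 - t) * (p \<bullet> x0 + a) + t * (p \<bullet> y + a)"
      "q \<bullet> ?u + b = (1 - t) * (q \<bullet> x0 + b) + t * (q \<bullet> y + b)"
      by (simp_all add: inner_add_right algebra_simps)
    with 1 show ?thesis unfolding h_def by (smt (verit) max_def)
  qed
  ultimately show "s / 2 * (norm (c - x0))\<^sup>2 + h x0
      \<le> s / 2 * (norm (c - ?u))\<^sup>2 + ((1 - t) * h x0 + t * h y)" by simp
qed

lemma conjugate_affine:
  fixes z :: "'a::real_inner"
  shows "conjugate (\<lambda>x. ereal (z \<bullet> x + b)) z = ereal (- b)"
  by (simp add: conjugate_def inner_commute)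

lemma norm_square_add_le: "(norm (a + b))\<^sup>2 \<le> 2 * (norm a)\<^sup>2 + 2 * (norm b)\<^sup>2"
  for a b :: "'a::real_normed_vector"
proof -
  have "(norm (a + b))\<^sup>2 \<le> (norm a + norm b)\<^sup>2" by (simp add: norm_triangle_ineq power_mono)
  also have "\<dots> \<le> 2 * (norm a)\<^sup>2 + 2 * (norm b)\<^sup>2"
    using sum_squares_bound[of "norm a" "norm b"] by (simp add: power2_sum)
  finally show ?thesis .
qed

text \<open>
  Let \<open>l\<close> be the linearization of \<open>f\<close> at \<open>x0\<close> minus the minorant.  It is affine, at most \<open>0\<close> at
  \<open>x1\<close>, and at least \<open>- |y - x0|^2 / (2 \<sigma>)\<close> at every \<open>y\<close>, since the minorant stays below \<open>f\<close> and \<open>f\<close> is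
  smooth.  An upper bound for \<open>l x\<close> follows from the lower bound at the reflected point \<open>2 x1 - x\<close>,
  because \<open>l\<close> is affine.
\<close>

lemma bundle_gap:
  fixes f :: "'a::euclidean_space \<Rightarrow> ereal"
  assumes pcc: "proper_closed_convex f"
    and sc: "strongly_convex \<sigma> (conjugate f)" and \<sigma>: "\<sigma> > 0"
    and f0: "f x0 = ereal r" and v: "v \<in> subdifferential f x0"
    and minor: "\<And>x. ereal (z \<bullet> (x - x1) + c) \<le> f x"
    and c: "v \<bullet> (x1 - x0) + r \<le> c"
  shows "f x \<le> ereal (z \<bullet> (x - x1) + c + 2 / \<sigma> * ((norm (x - x1))\<^sup>2 + (norm (x1 - x0))\<^sup>2))"
proof -
  note up = smooth_upper_bound[OF pcc sc \<sigma> f0 v]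
  \<comment> \<open>the mirror image of \<open>x\<close> at \<open>x1\<close>\<close>
  let ?y = "2 *\<^sub>R x1 - x"
  have n1: "(norm (x - x0))\<^sup>2 \<le> 2 * (norm (x - x1))\<^sup>2 + 2 * (norm (x1 - x0))\<^sup>2"
    using norm_square_add_le[of "x - x1" "x1 - x0"] by simp
  have n2: "(norm (?y - x0))\<^sup>2 \<le> 2 * (norm (x - x1))\<^sup>2 + 2 * (norm (x1 - x0))\<^sup>2"
    using norm_square_add_le[of "x1 - x" "x1 - x0"]
    by (simp add: norm_minus_commute scaleR_2 algebra_simps)
  have "z \<bullet> (?y - x1) + c \<le> r + v \<bullet> (?y - x0) + (norm (?y - x0))\<^sup>2 / (2 * \<sigma>)"
    using order_trans[OF minor[of ?y] up[of ?y]] by simp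
  moreover have "(norm (?y - x0))\<^sup>2 / (2 * \<sigma>) + (norm (x - x0))\<^sup>2 / (2 * \<sigma>)
      \<le> 2 / \<sigma> * ((norm (x - x1))\<^sup>2 + (norm (x1 - x0))\<^sup>2)"
  proof -
    have "((norm (?y - x0))\<^sup>2 + (norm (x - x0))\<^sup>2) / (2 * \<sigma>)
        \<le> (4 * ((norm (x - x1))\<^sup>2 + (norm (x1 - x0))\<^sup>2)) / (2 * \<sigma>)"
      using n1 n2 \<sigma> by (intro divide_right_mono) auto
    then show ?thesis by (simp add: add_divide_distrib)
  qed
  ultimately have "r + v \<bullet> (x - x0) + (norm (x - x0))\<^sup>2 / (2 * \<sigma>)
      \<le> z \<bullet> (x - x1) + c + 2 / \<sigma> * ((norm (x - x1))\<^sup>2 + (norm (x1 - x0))\<^sup>2)"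
    using c by (simp add: inner_diff_right scaleR_2 inner_add_right)
  then show ?thesis using order_trans[OF up[of x]] by simp
qed

section \<open>Kinetic energy\<close>

text \<open>
  The momentum \<open>y\<close> and the mass \<open>s\<close> give the position \<open>y / s\<close>.  In this form no
  position has to be assigned to an empty component.
\<close>

definition energy :: "'a::real_inner \<Rightarrow> real \<Rightarrow> real" where
  "energy y s = (norm y)\<^sup>2 / (2 * s)"

text \<open>
  The energy lost in a perfectly inelastic collision of two masses.
\<close>

definition merge_loss :: "'a::real_inner \<Rightarrow> real \<Rightarrow> 'a \<Rightarrow> real \<Rightarrow> real" where
  "merge_loss y s y' s' =
     s * s' / (2 * (s + s')) * (norm ((1 / s) *\<^sub>R y - (1 / s') *\<^sub>R y'))\<^sup>2"

lemma energy_eq: "s / 2 * (norm ((1 / s) *\<^sub>R y))\<^sup>2 = energy y s"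
  by (simp add: energy_def power_divide power2_eq_square)

lemma energy_scaled: "energy ((1 / d) *\<^sub>R y) (s / d) = energy y s / d"
  by (simp add: energy_def power_divide power2_eq_square)

lemma energy_merge:
  assumes "s \<ge> 0" "s = 0 \<Longrightarrow> y = 0" "s' > 0"
  shows "energy (y + y') (s + s') + merge_loss y s y' s' = energy y s + energy y' s'"
proof (cases "s = 0")
  case True
  then show ?thesis using assms by (simp add: energy_def merge_loss_def)
next
  case False
  then have s: "s > 0" using assms by simp
  define u where "u = (1 / s) *\<^sub>R y"
  define v where "v = (1 / s') *\<^sub>R y'"
  have y: "y = s *\<^sub>R u" "y' = s' *\<^sub>R v" using s assms(3) by (auto simp: u_def v_def)
  have n1: "(norm (y + y'))\<^sup>2 = s\<^sup>2 * (norm u)\<^sup>2 + 2 * s * s' * (u \<bullet> v) + s'\<^sup>2 * (norm v)\<^sup>2"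
    unfolding y power2_norm_eq_inner
    by (simp add: inner_add_left inner_add_right inner_commute power2_eq_square algebra_simps)
  have n2: "(norm (u - v))\<^sup>2 = (norm u)\<^sup>2 - 2 * (u \<bullet> v) + (norm v)\<^sup>2"
    unfolding power2_norm_eq_inner
    by (simp add: inner_diff_left inner_diff_right inner_commute algebra_simps)
  have e: "energy y s = s / 2 * (norm u)\<^sup>2" "energy y' s' = s' / 2 * (norm v)\<^sup>2"
    using energy_eq[of s y] energy_eq[of s' y'] by (auto simp: u_def v_def)
  have alg: "(s\<^sup>2 * a + 2 * s * s' * b + s'\<^sup>2 * c) / (2 * (s + s')) + s * s' / (2 * (s + s')) * (a - 2 * b + c)
      = s / 2 * a + s' / 2 * c" for a b c :: real
    using s assms(3) by (simp add: divide_simps) (simp add: power2_eq_square algebra_simps)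
  show ?thesis
    unfolding e merge_loss_def u_def[symmetric] v_def[symmetric] n2
    unfolding energy_def n1 by (rule alg)
qed

lemma merge_loss_nonneg: "s \<ge> 0 \<Longrightarrow> s' \<ge> 0 \<Longrightarrow> merge_loss y s y' s' \<ge> 0"
  by (simp add: merge_loss_def)

text \<open>
  Half the harmonic mean of two masses that are at least \<open>\<eta>\<close> is at least \<open>\<eta> / 2\<close>.
\<close>

lemma merge_loss_ge:
  assumes "\<eta> > 0" "s \<ge> \<eta>" "s' \<ge> \<eta>"
  shows "\<eta> / 4 * (norm ((1 / s) *\<^sub>R y - (1 / s') *\<^sub>R y'))\<^sup>2 \<le> merge_loss y s y' s'"
proof -
  have "\<eta> * s + \<eta> * s' \<le> s' * s + s * s'"
    by (intro add_mono mult_right_mono) (use assms in auto)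
  then have "\<eta> / 4 \<le> s * s' / (2 * (s + s'))"
    using assms by (simp add: field_simps)
  then show ?thesis unfolding merge_loss_def by (intro mult_right_mono) auto
qed

lemma merged_position:
  assumes "s > 0" "s' > 0"
  shows "norm ((1 / (s + s')) *\<^sub>R (y + y') - (1 / s) *\<^sub>R y)
           \<le> norm ((1 / s) *\<^sub>R y - (1 / s') *\<^sub>R (y'::'a::real_inner))"
proof -
  define u where "u = (1 / s) *\<^sub>R y"
  define v where "v = (1 / s') *\<^sub>R y'"
  have y: "y = s *\<^sub>R u" "y' = s' *\<^sub>R v" using assms by (auto simp: u_def v_def)
  have "(1 / (s + s')) *\<^sub>R (y + y') - u = (1 / (s + s')) *\<^sub>R (y + y' - (s + s') *\<^sub>R u)"
    using assms by (simp add: scaleR_diff_right)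
  also have "y + y' - (s + s') *\<^sub>R u = s' *\<^sub>R (v - u)"
    by (simp add: y algebra_simps)
  finally have "norm ((1 / (s + s')) *\<^sub>R (y + y') - u) = s' / (s + s') * norm (u - v)"
    using assms by (simp add: norm_minus_commute)
  also have "\<dots> \<le> 1 * norm (u - v)"
    by (rule mult_right_mono) (use assms in auto)
  finally show ?thesis by (simp add: u_def v_def)
qed

text \<open>
  The square is completed around an arbitrary test point \<open>x\<close>; the linear term sums to the momentum.
\<close>

lemma energy_square:
  assumes "s \<ge> 0" "s = 0 \<Longrightarrow> y = 0"
  shows "energy y s = y \<bullet> x - s / 2 * (norm x)\<^sup>2 + s / 2 * (norm (x - (1 / s) *\<^sub>R y))\<^sup>2"
proof (cases "s = 0")
  case False
  define u where "u = (1 / s) *\<^sub>R y"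
  have y: "y = s *\<^sub>R u" using False by (simp add: u_def)
  have "energy y s = s / 2 * (norm u)\<^sup>2" by (simp only: energy_eq u_def)
  moreover have "(norm (x - u))\<^sup>2 = (norm x)\<^sup>2 - 2 * (u \<bullet> x) + (norm u)\<^sup>2"
    unfolding power2_norm_eq_inner
    by (simp add: inner_diff_left inner_diff_right inner_commute algebra_simps)
  ultimately show ?thesis unfolding u_def[symmetric]
    by (simp only:) (simp add: y algebra_simps)
qed (use assms in \<open>simp add: energy_def\<close>)

text \<open>
  The conjugate inequality for the quadratic; for mass zero both sides vanish or the right one is
  infinite.
\<close>

lemma quad_term_ge:
  fixes x :: "'a::real_inner"
  assumes "s \<ge> 0"
  shows "ereal (s * (m \<bullet> x) - x \<bullet> w - s / 2 * (norm x)\<^sup>2) \<le> quad_term s m w"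
proof (cases "s = 0")
  case False
  define u where "u = (1 / s) *\<^sub>R w"
  have w: "w = s *\<^sub>R u" using False by (simp add: u_def)
  have "0 \<le> s / 2 * (norm ((m - u) - x))\<^sup>2" using assms by simp
  also have "(norm ((m - u) - x))\<^sup>2 = (norm (m - u))\<^sup>2 - 2 * ((m - u) \<bullet> x) + (norm x)\<^sup>2"
    unfolding power2_norm_eq_inner
    by (simp only: inner_diff_left[of "m - u" x] inner_diff_right[of _ "m - u" x])
      (simp add: inner_commute[of x "m - u"])
  finally have "s * (m \<bullet> x) - x \<bullet> w - s / 2 * (norm x)\<^sup>2 \<le> s / 2 * (norm (m - u))\<^sup>2"
    by (simp add: w inner_diff_left inner_commute[of x u] algebra_simps)
  then show ?thesis using False by (simp add: quad_term_def u_def)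
qed (simp add: quad_term_def)

section \<open>States and lists of operations\<close>

lemma s_of_Edge: "s_of S (Edge e) = sig_s S (fst e) - rho_s S e"
  and y_of_Edge: "y_of S (Edge e) = sig_y S (fst e) - rho_y S e"
  by (cases e; simp)+

lemma x_of_Edge:
  "s_of S (Edge e) \<noteq> 0 \<Longrightarrow> x_of S (Edge e) = (1 / s_of S (Edge e)) *\<^sub>R y_of S (Edge e)"
  by (cases e) (simp only: x_of.simps if_False)

lemma x_of_Node: "x_of S (Node i) = (1 / snode S i) *\<^sub>R ynode S i"
  by simp

(* the defining equations match literal pairs only; the lemmas above hold for every edge e *)
declare y_of.simps(2) [simp del] s_of.simps(2) [simp del] x_of.simps(2) [simp del]

lemma perform_list_append:
  "perform_list G f V2 (ps @ qs) S S' \<longleftrightarrow>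
     (\<exists>T. perform_list G f V2 ps S T \<and> perform_list G f V2 qs T S')"
  by (induction ps arbitrary: S) auto

lemma followed_by_split:
  assumes "followed_by p q ps"
  obtains ps1 ps2 where "ps = ps1 @ p # ps2" "q \<in> set ps2"
proof -
  obtain a b where ab: "a < b" "b < length ps" "ps ! a = p" "ps ! b = q"
    using assms by (auto simp: followed_by_def)
  have "ps = take a ps @ p # drop (Suc a) ps"
    using ab id_take_nth_drop[of a ps] by auto
  moreover have "q \<in> set (drop (Suc a) ps)"
    using ab by (auto simp: in_set_conv_nth intro!: exI[of _ "b - Suc a"])
  ultimately show ?thesis by (rule that)
qed

lemma perform_list_concat:
  assumes "\<And>k. k < m \<Longrightarrow> perform_list G f V2 (ops (a + k)) (st (a + k)) (st (Suc (a + k)))"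
  shows "perform_list G f V2 (concat (map (\<lambda>k. ops (a + k)) [0..<m])) (st a) (st (a + m))"
  using assms
proof (induction m)
  case (Suc m)
  then have "perform_list G f V2 (concat (map (\<lambda>k. ops (a + k)) [0..<m])) (st a) (st (a + m))"
    "perform_list G f V2 (ops (a + m)) (st (a + m)) (st (Suc (a + m)))" by simp_all
  then show ?case by (auto simp: perform_list_append)
qed simp

section \<open>Consensus along a strongly connected graph\<close>

text \<open>
  Induction along a path adds one \<open>\<delta>\<close> per arc.  The constant works for all position functions at once;
  it may be summed over all pairs of nodes since the graph is finite.
\<close>

lemma consensus_constant:
  assumes "pair_fin_digraph G" and sc: "strongly_connected (with_proj G)"
  obtains C :: real where "C \<ge> 0"
    "\<And>(x :: 'v \<Rightarrow> 'a::metric_space) \<delta> u v.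
       \<lbrakk>\<delta> \<ge> 0; \<forall>(i, j)\<in>parcs G. dist (x i) (x j) \<le> \<delta>; u \<in> pverts G; v \<in> pverts G\<rbrakk>
       \<Longrightarrow> dist (x u) (x v) \<le> C * \<delta>"
proof -
  interpret pair_fin_digraph G by fact
  let ?P = "\<lambda>u v c. c \<ge> 0 \<and> (\<forall>(x :: 'v \<Rightarrow> 'a) \<delta>. \<delta> \<ge> 0 \<longrightarrow>
      (\<forall>(i, j)\<in>parcs G. dist (x i) (x j) \<le> \<delta>) \<longrightarrow> dist (x u) (x v) \<le> c * \<delta>)"
  have "\<exists>c. ?P u v c" if uv: "u \<in> pverts G" "v \<in> pverts G" for u v
  proof -
    have "(u, v) \<in> rtrancl_on (pverts G) (parcs G)"
      using sc uv by (auto simp: strongly_connected_def reachable_def)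
    then show ?thesis
    proof (induction rule: rtrancl_on_induct)
      case base
      show ?case by (rule exI[of _ 0]) simp
    next
      case (step y z)
      then obtain c where c: "?P u y c" by blast
      have "?P u z (c + 1)"
      proof (intro conjI allI impI)
        show "c + 1 \<ge> 0" using c by simp
        fix x :: "'v \<Rightarrow> 'a" and \<delta> :: real
        assume \<delta>: "\<delta> \<ge> 0" and arcs: "\<forall>(i, j)\<in>parcs G. dist (x i) (x j) \<le> \<delta>"
        have "dist (x u) (x y) \<le> c * \<delta>" using c \<delta> arcs by blast
        moreover have "dist (x y) (x z) \<le> \<delta>" using step arcs by blast
        ultimately show "dist (x u) (x z) \<le> (c + 1) * \<delta>"
          using dist_triangle[of "x u" "x z" "x y"] by (simp add: distrib_right)
      qed
      then show ?case by blast
    qed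
  qed
  then have "\<forall>u v. \<exists>c. u \<in> pverts G \<longrightarrow> v \<in> pverts G \<longrightarrow> ?P u v c" by blast
  then obtain c where "\<forall>u v. u \<in> pverts G \<longrightarrow> v \<in> pverts G \<longrightarrow> ?P u v (c u v)"
    unfolding choice_iff by (elim exE)
  then have c: "?P u v (c u v)" if "u \<in> pverts G" "v \<in> pverts G" for u v using that by simp
  define C where "C = (\<Sum>u\<in>pverts G. \<Sum>v\<in>pverts G. c u v)"
  have le: "c u v \<le> C" if "u \<in> pverts G" "v \<in> pverts G" for u v
  proof -
    have "c u v \<le> (\<Sum>v\<in>pverts G. c u v)"
      by (rule member_le_sum) (use c that in auto)
    also have "\<dots> \<le> C" unfolding C_def
      by (rule member_le_sum[of u "pverts G" "\<lambda>u. \<Sum>v\<in>pverts G. c u v"]) (use c that in \<open>auto intro!: sum_nonneg\<close>)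
    finally show ?thesis .
  qed
  show ?thesis
  proof
    show "C \<ge> 0" unfolding C_def by (intro sum_nonneg) (use c in auto)
    fix x :: "'v \<Rightarrow> 'a" and \<delta> u v
    assume a: "\<delta> \<ge> 0" "\<forall>(i, j)\<in>parcs G. dist (x i) (x j) \<le> \<delta>" "u \<in> pverts G" "v \<in> pverts G"
    have "dist (x u) (x v) \<le> c u v * \<delta>" using c[OF a(3,4)] a(1,2) by blast
    also have "\<dots> \<le> C * \<delta>" by (rule mult_right_mono[OF le[OF a(3,4)] a(1)])
    finally show "dist (x u) (x v) \<le> C * \<delta>" .
  qed
qed

section \<open>The objective and Operations A and B\<close>

locale dual_ascent =
  fixes G :: "'v pair_pre_digraph"
    and f :: "'v \<Rightarrow> real^'m \<Rightarrow> ereal"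
    and V1 V2 :: "'v set"
    and \<sigma> :: real
  assumes graph: "pair_fin_digraph G"
    and parts: "V1 \<union> V2 = pverts G" "V1 \<inter> V2 = {}"
    and closed_convex: "\<And>i. i \<in> pverts G \<Longrightarrow> proper_closed_convex (f i)"
    and not_infinite: "\<And>i x. i \<in> V2 \<Longrightarrow> f i x \<noteq> \<infinity>"
    and \<sigma>_pos: "\<sigma> > 0"
    and conj_strong: "\<And>i. i \<in> pverts G \<Longrightarrow> strongly_convex \<sigma> (conjugate (f i))"
begin

interpretation pair_fin_digraph G by (rule graph)

lemma finite_parts [simp, intro]:
  "finite (pverts G)" "finite (parcs G)" "finite V1" "finite V2" "finite (comps G)"
proof -
  show *: "finite (pverts G)" "finite (parcs G)" by auto
  show "finite V1" "finite V2" using * parts by (metis finite_Un)+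
  show "finite (comps G)" using * by (simp add: comps_def)
qed

lemma V2_node: "i \<in> V2 \<Longrightarrow> i \<in> pverts G" using parts by blast

lemma arc_ends: "e \<in> parcs G \<Longrightarrow> fst e \<in> pverts G" "(i, j) \<in> parcs G \<Longrightarrow> j \<in> pverts G"
  using in_arcsD1[of "fst e" "snd e"] in_arcsD2[of i j] by auto

lemma sum_comps:
  "(\<Sum>\<alpha>\<in>comps G. h \<alpha>) = (\<Sum>i\<in>pverts G. h (Node i)) + (\<Sum>e\<in>parcs G. h (Edge e))"
  for h :: "'v comp \<Rightarrow> 'b::comm_monoid_add"
  unfolding comps_def
  by (subst sum.union_disjoint) (auto simp: sum.reindex inj_on_def)

text \<open>
  An empty edge component carries no momentum, so that the energy \<open>0 / 0 = 0\<close> is the right value and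
  merging is energetically consistent.
\<close>

definition admissible :: "('v, 'm) state \<Rightarrow> bool" where
  "admissible S \<longleftrightarrow>
     (\<forall>i\<in>pverts G. snode S i > 0) \<and>
     (\<forall>e\<in>parcs G. s_of S (Edge e) \<ge> 0 \<and> (s_of S (Edge e) = 0 \<longrightarrow> y_of S (Edge e) = 0)) \<and>
     (\<forall>i\<in>V2. (\<exists>b. minorant S i = (\<lambda>x. zvec S i \<bullet> x + b)) \<and>
              (\<forall>x. ereal (minorant S i x) \<le> f i x))"

definition dual_value :: "('v, 'm) state \<Rightarrow> 'v \<Rightarrow> ereal" where
  "dual_value S i =
     (if i \<in> V2 then conjugate (\<lambda>x. ereal (minorant S i x)) (zvec S i)
      else conjugate (f i) (zvec S i))"

definition total_energy :: "('v, 'm) state \<Rightarrow> real" where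
  "total_energy S = (\<Sum>\<alpha>\<in>comps G. energy (y_of S \<alpha>) (s_of S \<alpha>))"

abbreviation objective :: "('v, 'm) state \<Rightarrow> ereal" where
  "objective \<equiv> alg_objective G f V1 V2"

lemma objective_eq: "objective S = (\<Sum>i\<in>pverts G. dual_value S i) + ereal (total_energy S)"
proof -
  have "s_of S \<alpha> / 2 * (norm (x_of S \<alpha>))\<^sup>2 = energy (y_of S \<alpha>) (s_of S \<alpha>)" for \<alpha>
  proof (cases \<alpha>)
    case (Node i) then show ?thesis by (simp only: x_of.simps(1) s_of.simps(1) y_of.simps(1) energy_eq)
  next
    case (Edge e)
    then show ?thesis
    proof (cases "s_of S \<alpha> = 0")
      case True then show ?thesis by (simp add: energy_def)
    next
      case False then show ?thesis unfolding Edge by (simp only: x_of_Edge energy_eq not_False_eq_True)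
    qed
  qed
  moreover have "(\<Sum>i\<in>pverts G. dual_value S i) = (\<Sum>i\<in>V1. conjugate (f i) (zvec S i))
     + (\<Sum>i\<in>V2. conjugate (\<lambda>x. ereal (minorant S i x)) (zvec S i))"
    unfolding parts(1)[symmetric] using parts(2)
    by (subst sum.union_disjoint) (auto simp: dual_value_def intro!: arg_cong2[where f = "(+)"] sum.cong)
  ultimately show ?thesis by (simp add: alg_objective_def total_energy_def)
qed

lemma dual_value_V2:
  assumes "minorant S i = (\<lambda>x. zvec S i \<bullet> x + b)" "i \<in> V2"
  shows "dual_value S i = ereal (- b)"
  using assms by (simp add: dual_value_def conjugate_affine)

lemma dual_value_not_MInf:
  assumes "admissible S" "i \<in> pverts G"
  shows "dual_value S i \<noteq> -\<infinity>"
proof (cases "i \<in> V2")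
  case True
  then show ?thesis using assms dual_value_V2 by (fastforce simp: admissible_def)
next
  case False
  obtain x where x: "f i x \<noteq> \<infinity>" "f i x \<noteq> -\<infinity>"
    using closed_convex[OF assms(2)] by (auto simp: proper_closed_convex_def)
  then obtain r where "f i x = ereal r" by (cases "f i x") auto
  from conjugate_ge[of "f i" x r, OF this, of "zvec S i"] show ?thesis
    using False by (auto simp: dual_value_def)
qed

lemma sum_not_MInf: "(\<And>i. i \<in> A \<Longrightarrow> h i \<noteq> -\<infinity>) \<Longrightarrow> (\<Sum>i\<in>A. h i) \<noteq> (-\<infinity>::ereal)"
  by (induction A rule: infinite_finite_induct) auto

lemma objective_not_MInf: "admissible S \<Longrightarrow> objective S \<noteq> -\<infinity>"
  using sum_not_MInf[of "pverts G" "dual_value S"] dual_value_not_MInf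
  by (cases "\<Sum>i\<in>pverts G. dual_value S i") (auto simp: objective_eq)

lemma do_A_fields:
  defines "d i \<equiv> real (out_degree (with_proj G) i) + 1"
  shows "ynode (do_A G i S) = (ynode S)(i := (1 / d i) *\<^sub>R ynode S i)"
    "snode (do_A G i S) = (snode S)(i := snode S i / d i)"
    "y_of (do_A G i S) (Edge e) = y_of S (Edge e) + (if fst e = i then (1 / d i) *\<^sub>R ynode S i else 0)"
    "s_of (do_A G i S) (Edge e) = s_of S (Edge e) + (if fst e = i then snode S i / d i else 0)"
    "zvec (do_A G i S) = zvec S" "minorant (do_A G i S) = minorant S"
  by (simp_all add: do_A_def Let_def d_def s_of_Edge y_of_Edge)

lemma do_B_fields:
  "ynode (do_B i j S) = (ynode S)(j := ynode S j + y_of S (Edge (i, j)))"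
  "snode (do_B i j S) = (snode S)(j := snode S j + s_of S (Edge (i, j)))"
  "y_of (do_B i j S) (Edge e) = (if e = (i, j) then 0 else y_of S (Edge e))"
  "s_of (do_B i j S) (Edge e) = (if e = (i, j) then 0 else s_of S (Edge e))"
  "zvec (do_B i j S) = zvec S" "minorant (do_B i j S) = minorant S"
  by (auto simp add: do_B_def s_of_Edge y_of_Edge)

lemma admissible_A:
  assumes "admissible S" "i \<in> pverts G"
  shows "admissible (do_A G i S)"
proof -
  have "snode S i / (real (out_degree (with_proj G) i) + 1) > 0"
    using assms by (auto simp: admissible_def)
  moreover from this have "s_of S (Edge e) + snode S i / (real (out_degree (with_proj G) i) + 1) > 0"
    if "e \<in> parcs G" for e
    using assms(1) that by (intro add_nonneg_pos) (auto simp: admissible_def)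
  ultimately show ?thesis using assms
    unfolding admissible_def do_A_fields
    by (auto simp: less_le)
qed

lemma admissible_B:
  assumes "admissible S" "(i, j) \<in> parcs G"
  shows "admissible (do_B i j S)"
  using assms unfolding admissible_def do_B_fields by (auto intro: add_pos_nonneg)

lemma card_out: "card {e\<in>parcs G. fst e = i} = out_degree (with_proj G) i"
  by (simp add: out_degree_def out_arcs_def)

text \<open>
  Splitting a node into equal parts at the same position costs nothing; each part but one then collides
  with the mass on an outgoing edge.
\<close>

lemma energy_A:
  assumes adm: "admissible S" and i: "i \<in> pverts G"
  defines "d \<equiv> real (out_degree (with_proj G) i) + 1"
  shows "total_energy (do_A G i S)
     + (\<Sum>e\<in>{e\<in>parcs G. fst e = i}.
          merge_loss (y_of S (Edge e)) (s_of S (Edge e)) ((1 / d) *\<^sub>R ynode S i) (snode S i / d))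
     = total_energy S"
proof -
  let ?T = "do_A G i S" and ?y = "(1 / d) *\<^sub>R ynode S i" and ?s = "snode S i / d"
  let ?E = "{e\<in>parcs G. fst e = i}"
  let ?l = "\<lambda>e. merge_loss (y_of S (Edge e)) (s_of S (Edge e)) ?y ?s"
  let ?en = "\<lambda>S \<alpha>. energy (y_of S \<alpha>) (s_of S \<alpha>)"
  have d: "d > 0" by (simp add: d_def)
  have s: "?s > 0" using adm i d by (auto simp: admissible_def)
  have en: "energy ?y ?s = energy (ynode S i) (snode S i) / d" by (rule energy_scaled)
  have "(\<Sum>k\<in>pverts G. ?en ?T (Node k)) = energy ?y ?s + (\<Sum>k\<in>pverts G - {i}. ?en S (Node k))"
    using i by (subst sum.remove[of _ i]) (auto simp: do_A_fields d_def intro!: sum.cong)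
  then have 1: "(\<Sum>k\<in>pverts G. ?en ?T (Node k)) + energy (ynode S i) (snode S i)
      = energy ?y ?s + (\<Sum>k\<in>pverts G. ?en S (Node k))"
    using i by (simp add: sum.remove[of "pverts G" i])
  have "?en ?T (Edge e) + (if fst e = i then ?l e else 0)
      = ?en S (Edge e) + (if fst e = i then energy ?y ?s else 0)" if "e \<in> parcs G" for e
  proof (cases "fst e = i")
    case True
    have "?en ?T (Edge e) = energy (y_of S (Edge e) + ?y) (s_of S (Edge e) + ?s)"
      using True by (simp only: do_A_fields d_def if_True refl)
    then show ?thesis
      using energy_merge[of "s_of S (Edge e)" "y_of S (Edge e)" ?s ?y] adm that s True
      by (auto simp: admissible_def)
  qed (simp add: do_A_fields)
  then have "(\<Sum>e\<in>parcs G. ?en ?T (Edge e) + (if fst e = i then ?l e else 0))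
      = (\<Sum>e\<in>parcs G. ?en S (Edge e) + (if fst e = i then energy ?y ?s else 0))"
    by (rule sum.cong[OF refl])
  then have 2: "(\<Sum>e\<in>parcs G. ?en ?T (Edge e)) + (\<Sum>e\<in>?E. ?l e)
      = (\<Sum>e\<in>parcs G. ?en S (Edge e)) + real (card ?E) * energy ?y ?s"
    by (simp add: sum.distrib sum.If_cases Int_def)
  have "real (card ?E) = d - 1" by (simp add: card_out d_def)
  then have "real (card ?E) * energy ?y ?s + energy ?y ?s = energy (ynode S i) (snode S i)"
    using d unfolding en by (simp only:) (simp add: field_simps)
  with 1 2 show ?thesis by (simp add: total_energy_def sum_comps)
qed

lemma energy_B:
  assumes adm: "admissible S" and e: "(i, j) \<in> parcs G"
  shows "total_energy (do_B i j S)
     + merge_loss (y_of S (Edge (i, j))) (s_of S (Edge (i, j))) (ynode S j) (snode S j)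
     = total_energy S"
proof -
  let ?T = "do_B i j S"
  let ?en = "\<lambda>S \<alpha>. energy (y_of S \<alpha>) (s_of S \<alpha>)"
  let ?y = "y_of S (Edge (i, j))" and ?s = "s_of S (Edge (i, j))"
  have j: "j \<in> pverts G" using e arc_ends by blast
  have "(\<Sum>k\<in>pverts G. ?en ?T (Node k))
      = energy (?y + ynode S j) (?s + snode S j) + (\<Sum>k\<in>pverts G - {j}. ?en S (Node k))"
    using j by (subst sum.remove[of _ j]) (auto simp: do_B_fields add.commute intro!: sum.cong)
  then have 1: "(\<Sum>k\<in>pverts G. ?en ?T (Node k)) + energy (ynode S j) (snode S j)
      = energy (?y + ynode S j) (?s + snode S j) + (\<Sum>k\<in>pverts G. ?en S (Node k))"
    using j by (simp add: sum.remove[of "pverts G" j])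
  have "(\<Sum>k\<in>parcs G. ?en ?T (Edge k)) = (\<Sum>k\<in>parcs G - {(i, j)}. ?en S (Edge k))"
    using e by (subst sum.remove[of _ "(i, j)"])
      (auto simp: do_B_fields energy_def intro!: sum.cong)
  then have 2: "(\<Sum>k\<in>parcs G. ?en ?T (Edge k)) + energy ?y ?s = (\<Sum>k\<in>parcs G. ?en S (Edge k))"
    using e by (simp add: sum.remove[of "parcs G" "(i, j)"])
  have "energy (?y + ynode S j) (?s + snode S j) + merge_loss ?y ?s (ynode S j) (snode S j)
      = energy ?y ?s + energy (ynode S j) (snode S j)"
    using adm e j by (intro energy_merge) (auto simp: admissible_def)
  with 1 2 show ?thesis by (simp add: total_energy_def sum_comps)
qed

section \<open>Operation C\<close>

text \<open>
  For a test point \<open>x\<close>, the left-hand side is the Fenchel-Young gap at \<open>j\<close> after the step from \<open>S\<close> to \<open>T\<close>.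
  The bound tends to zero when \<open>x\<close> approaches the new position and the step becomes short.
\<close>

definition gap_bound :: "('v, 'm) state \<Rightarrow> ('v, 'm) state \<Rightarrow> 'v \<Rightarrow> bool" where
  "gap_bound S T j \<longleftrightarrow>
     (\<exists>\<kappa>. dual_value T j = ereal \<kappa> \<and>
       (\<forall>x. \<exists>F. f j x = ereal F \<and>
          F + \<kappa> - zvec T j \<bullet> x
            \<le> 2 / \<sigma> * ((norm (x - x_of T (Node j)))\<^sup>2 + (norm (x_of T (Node j) - x_of S (Node j)))\<^sup>2)))"

text \<open>
  The new dual variable is a subgradient at the new position, so Fenchel's equality holds there.
\<close>

lemma prox_node:
  assumes j: "j \<in> pverts G" and s: "s > 0"
    and am: "is_arg_min (\<lambda>x. ereal (s / 2 * (norm (c - x))\<^sup>2) + f j x) (\<lambda>_. True) xn"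
  defines "z \<equiv> s *\<^sub>R (c - xn)"
  obtains \<kappa> where "conjugate (f j) z = ereal \<kappa>"
    "\<And>w. ereal (\<kappa> + (w - z) \<bullet> xn) \<le> conjugate (f j) w"
    "\<And>x. f j x \<le> ereal (z \<bullet> x - \<kappa> + 2 / \<sigma> * (norm (x - xn))\<^sup>2)"
proof -
  obtain r where r: "f j xn = ereal r" "z \<in> subdifferential (f j) xn"
    using prox_subgradient[OF closed_convex[OF j] s am] unfolding z_def by blast
  show ?thesis
  proof
    show "conjugate (f j) z = ereal (z \<bullet> xn - r)" by (rule conjugate_at_subgradient[OF r])
    show "ereal (z \<bullet> xn - r + (w - z) \<bullet> xn) \<le> conjugate (f j) w" for w
    proof -
      have "z \<bullet> xn - r + (w - z) \<bullet> xn = xn \<bullet> w - r" by (simp add: inner_diff_left inner_commute[of w])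
      then show ?thesis using conjugate_ge[of "f j" xn r w] r(1) by (simp only:)
    qed
    fix x
    have "f j x \<le> ereal (r + z \<bullet> (x - xn) + (norm (x - xn))\<^sup>2 / (2 * \<sigma>))"
      by (rule smooth_upper_bound[OF closed_convex[OF j] conj_strong[OF j] \<sigma>_pos r])
    also have "(norm (x - xn))\<^sup>2 / (2 * \<sigma>) \<le> 2 / \<sigma> * (norm (x - xn))\<^sup>2"
      using \<sigma>_pos by (simp add: field_simps)
    then have "ereal (r + z \<bullet> (x - xn) + (norm (x - xn))\<^sup>2 / (2 * \<sigma>))
        \<le> ereal (z \<bullet> x - (z \<bullet> xn - r) + 2 / \<sigma> * (norm (x - xn))\<^sup>2)"
      by (simp add: inner_diff_right)
    finally show "f j x \<le> ereal (z \<bullet> x - (z \<bullet> xn - r) + 2 / \<sigma> * (norm (x - xn))\<^sup>2)" .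
  qed
qed

text \<open>
  The maximum of two affine minorants plays the role of \<open>f j\<close> in the proximal step; the new minorant is
  its supporting affine function at the new position.
\<close>

lemma bundle_node:
  fixes g :: "real^'m \<Rightarrow> real"
  assumes j: "j \<in> V2" and s: "s > 0"
    and g: "g = (\<lambda>x. w \<bullet> x + b)" "\<And>x. ereal (g x) \<le> f j x"
    and v: "v \<in> subdifferential (f j) x0"
  defines "h \<equiv> (\<lambda>x. max (g x) (v \<bullet> (x - x0) + real_of_ereal (f j x0)))"
  assumes am: "is_arg_min (\<lambda>x. h x + s / 2 * (norm (x - c))\<^sup>2) (\<lambda>_. True) xn"
  defines "z \<equiv> s *\<^sub>R (c - xn)"
  shows "ereal (z \<bullet> (x - xn) + h xn) \<le> f j x"
    and "(z \<bullet> xn - h xn) + (w - z) \<bullet> xn \<le> - b"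
    and "f j x \<le> ereal (z \<bullet> x - (z \<bullet> xn - h xn)
           + 2 / \<sigma> * ((norm (x - xn))\<^sup>2 + (norm (xn - x0))\<^sup>2))"
proof -
  have jV: "j \<in> pverts G" by (rule V2_node[OF j])
  obtain r where r: "f j x0 = ereal r"
    using not_infinite[OF j, of x0] closed_convex[OF jV]
    by (cases "f j x0") (auto simp: proper_closed_convex_def)
  have h: "h = (\<lambda>x. max (w \<bullet> x + b) (v \<bullet> x + (r - v \<bullet> x0)))"
    unfolding h_def by (simp add: g r inner_diff_right algebra_simps)
  have "h xn + z \<bullet> (y - xn) \<le> h y" for y
    using prox_max_affine[OF s, where p = w and a = b and q = v and b = "r - v \<bullet> x0" and c = c] am
    unfolding h z_def by blast
  moreover have "ereal (h y) \<le> f j y" for y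
  proof -
    have "ereal (v \<bullet> (y - x0) + r) \<le> f j y"
      using v r by (auto simp: subdifferential_def add.commute)
    then show ?thesis using g(2)[of y] by (simp add: h_def r max_def)
  qed
  ultimately show minor: "ereal (z \<bullet> (y - xn) + h xn) \<le> f j y" for y
    by (metis add.commute ereal_less_eq(3) order_trans)
  have "w \<bullet> xn + b \<le> h xn" by (simp add: h)
  then show "(z \<bullet> xn - h xn) + (w - z) \<bullet> xn \<le> - b" by (simp add: inner_diff_left)
  have "v \<bullet> (xn - x0) + r \<le> h xn" by (simp add: h inner_diff_right)
  from bundle_gap[OF closed_convex[OF jV] conj_strong[OF jV] \<sigma>_pos r v minor this, of x]
  show "f j x \<le> ereal (z \<bullet> x - (z \<bullet> xn - h xn)
           + 2 / \<sigma> * ((norm (x - xn))\<^sup>2 + (norm (xn - x0))\<^sup>2))"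
    by (simp add: inner_diff_right algebra_simps)
qed

text \<open>
  Both variants of Operation C in one form.  The third part compares the conjugates at the old and the
  new dual variable by the Fenchel-Young inequality at the new position \<open>xn\<close>.
\<close>

lemma perform_C:
  assumes adm: "admissible S" and j: "j \<in> pverts G" and C: "perform G f V2 (OpC j) S T"
  shows "\<exists>xn g. T = S\<lparr>ynode := (ynode S)(j := snode S j *\<^sub>R xn),
            zvec := (zvec S)(j := ynode S j + zvec S j - snode S j *\<^sub>R xn),
            minorant := (minorant S)(j := g)\<rparr> \<and>
    (j \<in> V2 \<longrightarrow> (\<exists>b. g = (\<lambda>x. zvec T j \<bullet> x + b)) \<and> (\<forall>x. ereal (g x) \<le> f j x)) \<and>
    dual_value T j + ereal ((snode S j *\<^sub>R (xn - x_of S (Node j))) \<bullet> xn) \<le> dual_value S j \<and>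
    gap_bound S T j"
proof -
  have s: "snode S j > 0" using adm j by (auto simp: admissible_def)
  have y: "ynode S j = snode S j *\<^sub>R x_of S (Node j)" using s by simp
  have z: "snode S j *\<^sub>R (x_temp S j - xn) = ynode S j + zvec S j - snode S j *\<^sub>R xn" for xn
    using s by (simp add: x_temp_def scaleR_diff_right)
  have zz: "zvec S j - (ynode S j + zvec S j - snode S j *\<^sub>R xn)
      = snode S j *\<^sub>R (xn - x_of S (Node j))" for xn
    by (subst y) (simp add: scaleR_diff_right algebra_simps del: x_of.simps)
  have finite_f: "\<exists>F. f j x = ereal F \<and> F \<le> B" if "f j x \<le> ereal B" for x B
    using that closed_convex[OF j] by (cases "f j x") (auto simp: proper_closed_convex_def)
  show ?thesis
  proof (cases "j \<in> V2")
    case False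
    then obtain xn where
      am: "is_arg_min (\<lambda>x. ereal (snode S j / 2 * (norm (x_temp S j - x))\<^sup>2) + f j x) (\<lambda>_. True) xn"
      and T: "T = S\<lparr>ynode := (ynode S)(j := snode S j *\<^sub>R xn),
               zvec := (zvec S)(j := ynode S j + zvec S j - snode S j *\<^sub>R xn)\<rparr>"
      using C by (auto simp: step_C1_def z)
    obtain \<kappa> where \<kappa>: "conjugate (f j) (zvec T j) = ereal \<kappa>"
      "\<And>w. ereal (\<kappa> + (w - zvec T j) \<bullet> xn) \<le> conjugate (f j) w"
      "\<And>x. f j x \<le> ereal (zvec T j \<bullet> x - \<kappa> + 2 / \<sigma> * (norm (x - xn))\<^sup>2)"
      using prox_node[OF j s am] by (auto simp: z T)
    show ?thesis
    proof (intro exI[of _ xn] exI[of _ "minorant S j"] conjI impI)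
      show "T = S\<lparr>ynode := (ynode S)(j := snode S j *\<^sub>R xn),
            zvec := (zvec S)(j := ynode S j + zvec S j - snode S j *\<^sub>R xn),
            minorant := (minorant S)(j := minorant S j)\<rparr>" by (simp add: T)
      show "dual_value T j + ereal ((snode S j *\<^sub>R (xn - x_of S (Node j))) \<bullet> xn) \<le> dual_value S j"
        using False \<kappa>(1) \<kappa>(2)[of "zvec S j"]
        by (simp add: dual_value_def T zz del: x_of.simps)
      have xT: "x_of T (Node j) = xn" using s by (simp add: T)
      show "gap_bound S T j"
        unfolding gap_bound_def
      proof (intro exI conjI allI)
        show "dual_value T j = ereal \<kappa>" using False \<kappa>(1) by (simp add: dual_value_def)
        fix x
        obtain F where F: "f j x = ereal F" "F \<le> zvec T j \<bullet> x - \<kappa> + 2 / \<sigma> * (norm (x - xn))\<^sup>2"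
          using finite_f[OF \<kappa>(3)] by blast
        have "0 \<le> 2 / \<sigma> * (norm (xn - x_of S (Node j)))\<^sup>2" using \<sigma>_pos by simp
        with F(2) show "real_of_ereal (f j x) + \<kappa> - zvec T j \<bullet> x
            \<le> 2 / \<sigma> * ((norm (x - x_of T (Node j)))\<^sup>2 + (norm (x_of T (Node j) - x_of S (Node j)))\<^sup>2)"
          unfolding xT F(1) by (simp add: distrib_left del: x_of.simps)
        show "f j x = ereal (real_of_ereal (f j x))" by (simp add: F)
      qed
    qed (use False in simp_all)
  next
    case True
    define h where "h v x = max (minorant S j x) (v \<bullet> (x - x_of S (Node j)) + real_of_ereal (f j (x_of S (Node j))))" for v x
    obtain v xn where
      v: "v \<in> subdifferential (f j) (x_of S (Node j))"
      and am: "is_arg_min (\<lambda>x. h v x + snode S j / 2 * (norm (x - x_temp S j))\<^sup>2) (\<lambda>_. True) xn"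
      and T: "T = S\<lparr>ynode := (ynode S)(j := snode S j *\<^sub>R xn),
               zvec := (zvec S)(j := snode S j *\<^sub>R (x_temp S j - xn)),
               minorant := (minorant S)(j := (\<lambda>x. (snode S j *\<^sub>R (x_temp S j - xn)) \<bullet> (x - xn) + h v xn))\<rparr>"
    proof -
      have "step_C2 f j S T" using C True by simp
      then show ?thesis using that unfolding step_C2_def Let_def h_def by blast
    qed
    obtain b where g: "minorant S j = (\<lambda>x. zvec S j \<bullet> x + b)" "\<And>x. ereal (minorant S j x) \<le> f j x"
      using adm True unfolding admissible_def by blast
    have zT: "zvec T j = snode S j *\<^sub>R (x_temp S j - xn)" by (simp add: T)
    note B = bundle_node[OF True s g v am[unfolded h_def], folded h_def, folded zT]
    have mT: "minorant T j = (\<lambda>x. zvec T j \<bullet> x + (h v xn - zvec T j \<bullet> xn))"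
      by (simp add: T inner_diff_right algebra_simps)
    note dT = dual_value_V2[OF mT True]
    have xT: "x_of T (Node j) = xn" using s by (simp add: T)
    show ?thesis
    proof (intro exI[of _ xn] exI[of _ "minorant T j"] conjI[of "T = _"] conjI[of "_ \<longrightarrow> _"] conjI[of "_ \<le> _"] impI)
      show "T = S\<lparr>ynode := (ynode S)(j := snode S j *\<^sub>R xn),
            zvec := (zvec S)(j := ynode S j + zvec S j - snode S j *\<^sub>R xn),
            minorant := (minorant S)(j := minorant T j)\<rparr>" by (simp add: T z)
      have "ereal (minorant T j x) \<le> f j x" for x
        using B(1)[of x] by (simp add: mT inner_diff_right algebra_simps)
      then show "(\<exists>b. minorant T j = (\<lambda>x. zvec T j \<bullet> x + b)) \<and> (\<forall>x. ereal (minorant T j x) \<le> f j x)"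
        using mT by blast
      have "zvec S j - zvec T j = snode S j *\<^sub>R (xn - x_of S (Node j))"
        unfolding zT z zz ..
      then show "dual_value T j + ereal ((snode S j *\<^sub>R (xn - x_of S (Node j))) \<bullet> xn) \<le> dual_value S j"
        using B(2) unfolding dT dual_value_V2[OF g(1) True] by (simp del: x_of.simps)
      show "gap_bound S T j"
        unfolding gap_bound_def
      proof (intro exI conjI allI)
        show "dual_value T j = ereal (zvec T j \<bullet> xn - h v xn)" by (simp add: dT)
        fix x
        obtain F where F: "f j x = ereal F" "F \<le> zvec T j \<bullet> x - (zvec T j \<bullet> xn - h v xn)
           + 2 / \<sigma> * ((norm (x - xn))\<^sup>2 + (norm (xn - x_of S (Node j)))\<^sup>2)"
          using finite_f[OF B(3)] by blast
        show "f j x = ereal (real_of_ereal (f j x))" by (simp add: F)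
        show "real_of_ereal (f j x) + (zvec T j \<bullet> xn - h v xn) - zvec T j \<bullet> x
            \<le> 2 / \<sigma> * ((norm (x - x_of T (Node j)))\<^sup>2 + (norm (x_of T (Node j) - x_of S (Node j)))\<^sup>2)"
          using F(2) unfolding xT F(1) by (simp del: x_of.simps)
      qed
    qed
  qed
qed

text \<open>
  The momentum that leaves \<open>y\<close> enters \<open>z\<close>, so the linear part of the change of the energy is cancelled
  by the change of the conjugate.  A strict decrease by half the mass times the squared displacement
  is left over.
\<close>

lemma perform_C_effect:
  assumes adm: "admissible S" and j: "j \<in> pverts G" and C: "perform G f V2 (OpC j) S T"
  shows "admissible T"
    and "gap_bound S T j"
    and "objective T + ereal (snode S j / 2 * (norm (x_of T (Node j) - x_of S (Node j)))\<^sup>2) \<le> objective S"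
    and "snode T = snode S" "sig_y T = sig_y S" "sig_s T = sig_s S" "rho_y T = rho_y S" "rho_s T = rho_s S"
    and "ynode T j + zvec T j = ynode S j + zvec S j"
    and "i \<noteq> j \<Longrightarrow> ynode T i = ynode S i \<and> zvec T i = zvec S i \<and> minorant T i = minorant S i"
proof -
  obtain xn g where
    T: "T = S\<lparr>ynode := (ynode S)(j := snode S j *\<^sub>R xn),
            zvec := (zvec S)(j := ynode S j + zvec S j - snode S j *\<^sub>R xn),
            minorant := (minorant S)(j := g)\<rparr>"
    and g: "j \<in> V2 \<Longrightarrow> (\<exists>b. g = (\<lambda>x. zvec T j \<bullet> x + b)) \<and> (\<forall>x. ereal (g x) \<le> f j x)"
    and dec: "dual_value T j + ereal ((snode S j *\<^sub>R (xn - x_of S (Node j))) \<bullet> xn) \<le> dual_value S j"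
    and gap: "gap_bound S T j"
    using perform_C[OF assms] by blast
  have s: "snode S j > 0" using adm j by (auto simp: admissible_def)
  have xT: "x_of T (Node j) = xn" using s by (simp add: T)
  show "gap_bound S T j" by (rule gap)
  show "snode T = snode S" "sig_y T = sig_y S" "sig_s T = sig_s S" "rho_y T = rho_y S" "rho_s T = rho_s S"
    "ynode T j + zvec T j = ynode S j + zvec S j"
    "i \<noteq> j \<Longrightarrow> ynode T i = ynode S i \<and> zvec T i = zvec S i \<and> minorant T i = minorant S i"
    by (simp_all add: T)
  show "admissible T"
    unfolding admissible_def
  proof (intro conjI ballI)
    fix i assume i: "i \<in> V2"
    show "\<exists>b. minorant T i = (\<lambda>x. zvec T i \<bullet> x + b)" "\<forall>x. ereal (minorant T i x) \<le> f i x"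
      using i g adm by (cases "i = j"; auto simp: T admissible_def)+
  qed (use adm in \<open>auto simp: T admissible_def s_of_Edge y_of_Edge\<close>)
  let ?l = "snode S j / 2 * (norm (xn - x_of S (Node j)))\<^sup>2"
  let ?i = "(snode S j *\<^sub>R (xn - x_of S (Node j))) \<bullet> xn"
  let ?en = "\<lambda>S \<alpha>. energy (y_of S \<alpha>) (s_of S \<alpha>)"
  \<comment> \<open>the energy and the conjugates of all other components are unchanged\<close>
  define R where "R = (\<Sum>\<alpha>\<in>comps G - {Node j}. ?en S \<alpha>)"
  define D where "D = (\<Sum>i\<in>pverts G - {j}. dual_value S i)"
  have jc: "Node j \<in> comps G" using j by (simp add: comps_def)
  have "?en T \<alpha> = ?en S \<alpha>" if "\<alpha> \<noteq> Node j" for \<alpha>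
    using that by (cases \<alpha>) (auto simp: T s_of_Edge y_of_Edge)
  then have eT: "total_energy T = ?en T (Node j) + R"
    using jc unfolding total_energy_def R_def by (subst sum.remove[of _ "Node j"]) auto
  have eS: "total_energy S = ?en S (Node j) + R"
    using jc unfolding total_energy_def R_def by (subst sum.remove[of _ "Node j"]) auto
  have "dual_value T i = dual_value S i" if "i \<noteq> j" for i
    using that by (simp add: dual_value_def T)
  then have dT: "(\<Sum>i\<in>pverts G. dual_value T i) = dual_value T j + D"
    using j unfolding D_def by (subst sum.remove[of _ j]) auto
  have dS: "(\<Sum>i\<in>pverts G. dual_value S i) = dual_value S j + D"
    using j unfolding D_def by (subst sum.remove[of _ j]) auto
  have "?en T (Node j) = snode S j / 2 * (norm xn)\<^sup>2"
    using energy_eq[of "snode S j" "snode S j *\<^sub>R xn"] s by (simp add: T)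
  moreover have "?en S (Node j) = snode S j / 2 * (norm (x_of S (Node j)))\<^sup>2"
    by (simp only: energy_eq x_of_Node s_of.simps(1) y_of.simps(1))
  moreover have "s / 2 * (norm a)\<^sup>2 + s / 2 * (norm (a - b))\<^sup>2 = s / 2 * (norm b)\<^sup>2 + (s *\<^sub>R (a - b)) \<bullet> a"
    for a b :: "real^'m" and s
    unfolding power2_norm_eq_inner
    by (simp add: inner_diff_left inner_diff_right inner_commute algebra_simps)
  ultimately have en: "?en T (Node j) + ?l = ?en S (Node j) + ?i" by (simp only:)
  obtain \<kappa> where \<kappa>: "dual_value T j = ereal \<kappa>" using gap by (auto simp: gap_bound_def)
  have "objective T + ereal ?l = ereal (\<kappa> + ?i) + (D + ereal (?en S (Node j) + R))"
    unfolding objective_eq dT eT \<kappa> using en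
    by (cases D) (simp_all add: algebra_simps del: x_of.simps)
  also have "\<dots> \<le> dual_value S j + (D + ereal (?en S (Node j) + R))"
    by (rule add_right_mono) (use dec in \<open>simp add: \<kappa> del: x_of.simps\<close>)
  also have "\<dots> = objective S" unfolding objective_eq dS eS by (simp add: add.assoc)
  finally show "objective T + ereal (snode S j / 2 * (norm (x_of T (Node j) - x_of S (Node j)))\<^sup>2) \<le> objective S"
    unfolding xT .
qed

section \<open>Conserved and monotone quantities\<close>

lemma operation_cases:
  assumes "p \<in> operations G"
  obtains i where "p = OpA i" "i \<in> pverts G"
  | i j where "p = OpB (i, j)" "(i, j) \<in> parcs G"
  | j where "p = OpC j" "j \<in> pverts G"
  using assms by (auto simp: operations_def)

definition node_count :: real where
  "node_count = real (card (pverts G))"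

text \<open>
  A conserved quantity; its value fixes the linear term of the duality gap.
\<close>

definition momentum :: "('v, 'm) state \<Rightarrow> real^'m" where
  "momentum S = (\<Sum>\<alpha>\<in>comps G. y_of S \<alpha>) + (\<Sum>i\<in>pverts G. zvec S i)"

lemma momentum_A:
  assumes i: "i \<in> pverts G"
  shows "momentum (do_A G i S) = momentum S"
proof -
  let ?T = "do_A G i S"
  define d where "d = real (out_degree (with_proj G) i) + 1"
  let ?y = "(1 / d) *\<^sub>R ynode S i"
  have "(\<Sum>k\<in>pverts G. ynode ?T k) = ?y + (\<Sum>k\<in>pverts G - {i}. ynode S k)"
    using i by (subst sum.remove[of _ i]) (auto simp: do_A_fields d_def intro!: sum.cong)
  then have 1: "(\<Sum>k\<in>pverts G. ynode ?T k) + ynode S i = ?y + (\<Sum>k\<in>pverts G. ynode S k)"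
    using i by (simp add: sum.remove[of "pverts G" i])
  have "(\<Sum>e\<in>parcs G. y_of ?T (Edge e))
      = (\<Sum>e\<in>parcs G. y_of S (Edge e)) + real (card {e\<in>parcs G. fst e = i}) *\<^sub>R ?y"
    by (simp add: do_A_fields d_def sum.distrib sum.If_cases Int_def scaleR_conv_of_real sum_constant_scaleR del: scaleR_scaleR)
  also have "real (card {e\<in>parcs G. fst e = i}) *\<^sub>R ?y = d *\<^sub>R ?y - ?y"
  proof -
    have "real (card {e\<in>parcs G. fst e = i}) = d - 1" by (simp add: card_out d_def)
    then show ?thesis by (simp only: scaleR_left_diff_distrib scaleR_one)
  qed
  also have "d *\<^sub>R ?y = ynode S i" by (simp add: d_def add_nonneg_eq_0_iff)
  finally have 2: "(\<Sum>e\<in>parcs G. y_of ?T (Edge e)) + ?y = (\<Sum>e\<in>parcs G. y_of S (Edge e)) + ynode S i"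
    by simp
  have "a + c = a' + c'" if "a + b = b' + a'" "c + b' = c' + b" for a b c a' b' c' :: "real^'m"
  proof -
    have "a = b' + a' - b" "c = c' + b - b'"
      unfolding that(1)[symmetric] that(2)[symmetric] by simp_all
    then show ?thesis by simp
  qed
  from this[OF 1 2] show ?thesis
    by (simp add: momentum_def sum_comps do_A_fields)
qed

lemma momentum_B:
  assumes e: "(i, j) \<in> parcs G"
  shows "momentum (do_B i j S) = momentum S"
proof -
  have j: "j \<in> pverts G" using e arc_ends by blast
  have "(\<Sum>k\<in>pverts G. ynode (do_B i j S) k) = (\<Sum>k\<in>pverts G. ynode S k) + y_of S (Edge (i, j))"
    using j by (simp add: sum.remove[of _ j] do_B_fields)
  moreover have "(\<Sum>k\<in>parcs G. y_of (do_B i j S) (Edge k)) + y_of S (Edge (i, j))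
      = (\<Sum>k\<in>parcs G. y_of S (Edge k))"
    using e by (simp add: sum.remove[of _ "(i, j)"] do_B_fields)
  ultimately show ?thesis by (simp add: momentum_def sum_comps do_B_fields algebra_simps)
qed

lemma momentum_C:
  assumes "admissible S" "j \<in> pverts G" "perform G f V2 (OpC j) S T"
  shows "momentum T = momentum S"
proof -
  note C = perform_C_effect[OF assms]
  have "ynode T k + zvec T k = ynode S k + zvec S k" for k
    using C(9) C(10)[of k] by (cases "k = j") auto
  then have "(\<Sum>k\<in>pverts G. ynode T k + zvec T k) = (\<Sum>k\<in>pverts G. ynode S k + zvec S k)"
    by simp
  moreover have "y_of T (Edge e) = y_of S (Edge e)" for e by (simp add: y_of_Edge C)
  ultimately show ?thesis
    by (simp add: momentum_def sum_comps sum.distrib algebra_simps)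
qed

lemma objective_same_dual:
  assumes "zvec T = zvec S" "minorant T = minorant S"
  shows "objective T = (\<Sum>i\<in>pverts G. dual_value S i) + ereal (total_energy T)"
  unfolding objective_eq dual_value_def assms ..

lemma perform_invariants:
  assumes adm: "admissible S" and p: "p \<in> operations G" and perf: "perform G f V2 p S T"
  shows "admissible T" and "momentum T = momentum S" and "objective T \<le> objective S"
proof -
  have "admissible T \<and> momentum T = momentum S \<and> objective T \<le> objective S"
    using p
  proof (cases rule: operation_cases)
    case (1 i)
    then have T: "T = do_A G i S" using perf by simp
    have "total_energy T \<le> total_energy S"
      unfolding T energy_A[OF adm 1(2), symmetric] using adm 1(2)
      by (auto intro!: sum_nonneg merge_loss_nonneg simp: admissible_def order.strict_implies_order)
    then have "objective T \<le> objective S"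
      using objective_same_dual[of T S] objective_eq[of S]
      by (simp add: T do_A_fields add_left_mono)
    then show ?thesis using admissible_A[OF adm 1(2)] momentum_A[OF 1(2)] T by simp
  next
    case (2 i j)
    then have T: "T = do_B i j S" using perf by simp
    have "j \<in> pverts G" using 2 arc_ends by blast
    then have "total_energy T \<le> total_energy S"
      unfolding T energy_B[OF adm 2(2), symmetric] using adm 2(2)
      by (auto intro!: merge_loss_nonneg simp: admissible_def order.strict_implies_order)
    then have "objective T \<le> objective S"
      using objective_same_dual[of T S] objective_eq[of S]
      by (simp add: T do_B_fields add_left_mono)
    then show ?thesis using admissible_B[OF adm 2(2)] momentum_B[OF 2(2)] T by simp
  next
    case (3 j)
    note C = perform_C_effect[OF adm 3(2) perf[unfolded 3(1)]]
    have "0 \<le> snode S j / 2 * (norm (x_of T (Node j) - x_of S (Node j)))\<^sup>2"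
      by (rule mult_nonneg_nonneg) (use adm 3(2) in \<open>auto simp: admissible_def less_imp_le\<close>)
    then have "objective T \<le> objective S"
      using C(3) by (cases "objective T"; cases "objective S") (auto simp del: x_of.simps)
    then show ?thesis using C momentum_C[OF adm 3(2) perf[unfolded 3(1)]] by blast
  qed
  then show "admissible T" "momentum T = momentum S" "objective T \<le> objective S" by auto
qed

lemma perform_list_invariants:
  assumes "admissible S" "set ps \<subseteq> operations G" "perform_list G f V2 ps S T"
  shows "admissible T \<and> momentum T = momentum S \<and> objective T \<le> objective S"
  using assms
proof (induction ps arbitrary: S)
  case (Cons p ps)
  then obtain U where "perform G f V2 p S U" "perform_list G f V2 ps U T" by auto
  with Cons perform_invariants[of S p U] show ?case by (auto intro: order_trans)
qed auto

lemma initial_state_invariants: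
  assumes "initial_state G f V1 V2 xbar S"
  shows "admissible S" and "momentum S = node_count *\<^sub>R mean_vec G xbar"
proof -
  obtain y0 where mean: "mean_vec G y0 = mean_vec G xbar"
    and y0: "\<forall>i\<in>V1. ynode S i = y0 i" "\<forall>i\<in>V2. ynode S i = y0 i - zvec S i"
    and node: "\<forall>i\<in>pverts G. snode S i = 1 \<and> sig_y S i = 0 \<and> sig_s S i = 0"
    and rho: "\<forall>e\<in>parcs G. rho_y S e = 0 \<and> rho_s S e = 0"
    and z: "\<forall>i\<in>V1. zvec S i = 0"
    and V2: "\<forall>i\<in>V2. (\<exists>b. minorant S i = (\<lambda>x. zvec S i \<bullet> x + b)) \<and> (\<forall>x. ereal (minorant S i x) \<le> f i x)"
    using assms unfolding initial_state_def by (elim conjE exE) (rule that)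
  have edge: "y_of S (Edge e) = 0" "s_of S (Edge e) = 0" if "e \<in> parcs G" for e
    using that arc_ends(1)[OF that] node rho by (simp_all add: y_of_Edge s_of_Edge)
  show "admissible S" using node edge V2 unfolding admissible_def by auto
  have "ynode S i + zvec S i = y0 i" if "i \<in> pverts G" for i
  proof -
    have "i \<in> V1 \<or> i \<in> V2" using that parts by blast
    then show ?thesis using y0 z by auto
  qed
  then have "(\<Sum>i\<in>pverts G. ynode S i + zvec S i) = (\<Sum>i\<in>pverts G. y0 i)" by (rule sum.cong[OF refl])
  then have "momentum S = (\<Sum>i\<in>pverts G. y0 i)"
    by (simp add: momentum_def sum_comps edge sum.distrib)
  also have "\<dots> = node_count *\<^sub>R mean_vec G y0"
    by (cases "pverts G = {}") (simp_all add: node_count_def mean_vec_def)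
  finally show "momentum S = node_count *\<^sub>R mean_vec G xbar" by (simp add: mean)
qed

section \<open>A small decrease bounds the motion\<close>

definition mass_at_least :: "real \<Rightarrow> ('v, 'm) state \<Rightarrow> bool" where
  "mass_at_least \<eta> S \<longleftrightarrow>
     (\<forall>i\<in>pverts G. \<eta> \<le> snode S i) \<and>
     (\<forall>e\<in>parcs G. s_of S (Edge e) = 0 \<or> \<eta> \<le> s_of S (Edge e))"

text \<open>
  Operation A divides a mass by at most this factor, and no other operation shrinks a positive mass
  without emptying the component.
\<close>

definition dilution :: real where
  "dilution = real (card (parcs G)) + 1"

lemma dilution_ge: "dilution \<ge> 1" "real (out_degree (with_proj G) i) + 1 \<le> dilution"
  unfolding dilution_def card_out[symmetric] by (auto intro: card_mono)

lemma mass_at_least_mono: "mass_at_least \<eta> S \<Longrightarrow> \<eta>' \<le> \<eta> \<Longrightarrow> mass_at_least \<eta>' S"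
  unfolding mass_at_least_def by force

text \<open>
  The lower bound deteriorates by the factor \<open>dilution\<close> with every operation.  The bounds on
  the masses are known at the ends of iterations only; since the number of operations is bounded,
  this crude estimate covers the states in between.
\<close>

lemma perform_mass:
  assumes adm: "admissible S" and p: "p \<in> operations G" and perf: "perform G f V2 p S T"
    and mass: "mass_at_least (\<eta> * dilution) S" and \<eta>: "\<eta> > 0"
  shows "mass_at_least \<eta> T"
proof -
  have m: "mass_at_least \<eta> S"
    by (rule mass_at_least_mono[OF mass]) (use \<eta> dilution_ge in auto)
  show ?thesis
    using p
  proof (cases rule: operation_cases)
    case (1 i)
    then have T: "T = do_A G i S" using perf by simp
    let ?d = "real (out_degree (with_proj G) i) + 1"
    have "\<eta> * ?d \<le> \<eta> * dilution" using \<eta> dilution_ge by (intro mult_left_mono) auto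
    also have "\<dots> \<le> snode S i" using mass 1 by (auto simp: mass_at_least_def)
    finally have "\<eta> \<le> snode S i / ?d" by (subst pos_le_divide_eq) (auto simp: add_nonneg_pos)
    moreover from this have "\<eta> \<le> s_of S (Edge e) + snode S i / ?d" if "e \<in> parcs G" for e
      using adm that by (force simp: admissible_def)
    ultimately show ?thesis using m unfolding T mass_at_least_def do_A_fields by auto
  next
    case (2 i j)
    then have T: "T = do_B i j S" using perf by simp
    have "s_of S (Edge (i, j)) \<ge> 0" using adm 2 by (auto simp: admissible_def)
    then show ?thesis using m unfolding T mass_at_least_def do_B_fields by force
  next
    case (3 j)
    note C = perform_C_effect[OF adm 3(2) perf[unfolded 3(1)]]
    show ?thesis using m by (simp add: mass_at_least_def s_of_Edge C)
  qed
qed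

text \<open>
  All displacements that one operation can cause, with a common bound.  For Operation B the edge
  component disappears, and its distance to the node that absorbs it is recorded instead.  For
  Operation A the edge component may be new, and its distance to the emitting node is recorded.
\<close>

definition small_step :: "real \<Rightarrow> 'v operation \<Rightarrow> ('v, 'm) state \<Rightarrow> ('v, 'm) state \<Rightarrow> bool" where
  "small_step \<delta> p S T \<longleftrightarrow>
     (\<forall>i\<in>pverts G. dist (x_of S (Node i)) (x_of T (Node i)) \<le> \<delta>) \<and>
     (\<forall>e\<in>parcs G. p \<noteq> OpB e \<longrightarrow> s_of S (Edge e) > 0 \<longrightarrow>
        s_of T (Edge e) > 0 \<and> dist (x_of S (Edge e)) (x_of T (Edge e)) \<le> \<delta>) \<and>
     (\<forall>i j. p = OpB (i, j) \<longrightarrow> s_of S (Edge (i, j)) > 0 \<longrightarrow>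
        dist (x_of S (Edge (i, j))) (x_of S (Node j)) \<le> \<delta>) \<and>
     (\<forall>e\<in>parcs G. p = OpA (fst e) \<longrightarrow>
        s_of T (Edge e) > 0 \<and> dist (x_of S (Node (fst e))) (x_of T (Edge e)) \<le> \<delta>)"

lemma sq_bound_imp_le:
  assumes "\<eta> > 0" "\<delta> \<ge> 0" "\<eta> / 4 * (norm d)\<^sup>2 \<le> \<eta> / 4 * \<delta>\<^sup>2"
  shows "norm d \<le> \<delta>"
  using assms by (auto intro!: power2_le_imp_le[of "norm d" \<delta>])

lemma small_step_A:
  assumes adm: "admissible S" and i: "i \<in> pverts G" and T: "T = do_A G i S"
    and mS: "mass_at_least \<eta> S" and mT: "mass_at_least \<eta> T" and \<eta>: "\<eta> > 0" and \<delta>: "\<delta> \<ge> 0"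
    and le: "total_energy S \<le> total_energy T + \<eta> / 4 * \<delta>\<^sup>2"
  shows "small_step \<delta> (OpA i) S T"
proof -
  define d where "d = real (out_degree (with_proj G) i) + 1"
  let ?y = "(1 / d) *\<^sub>R ynode S i" and ?s = "snode S i / d"
  note F = do_A_fields[of i S, folded d_def, folded T]
  have d: "d > 0" by (simp add: d_def add_nonneg_pos)
  have s: "?s > 0" using adm i d by (auto simp: admissible_def)
  have s\<eta>: "?s \<ge> \<eta>" using mT i by (auto simp: mass_at_least_def F)
  have xi: "(1 / ?s) *\<^sub>R ?y = x_of S (Node i)" using d by simp
  have node: "x_of T (Node k) = x_of S (Node k)" for k
    using d by (auto simp: F)
  have edge: "s_of T (Edge e) > 0 \<and> dist (x_of S (Node i)) (x_of T (Edge e)) \<le> \<delta> \<and>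
      (s_of S (Edge e) > 0 \<longrightarrow> dist (x_of S (Edge e)) (x_of T (Edge e)) \<le> \<delta>)"
    if e: "e \<in> parcs G" "fst e = i" for e
  proof -
    let ?ye = "y_of S (Edge e)" and ?se = "s_of S (Edge e)"
    have F': "y_of T (Edge e) = ?ye + ?y" "s_of T (Edge e) = ?se + ?s" using e by (auto simp: F)
    have se: "?se \<ge> 0" "?se = 0 \<Longrightarrow> ?ye = 0" using adm e by (auto simp: admissible_def)
    have sT: "?se + ?s > 0" using se s by simp
    then have xT: "x_of T (Edge e) = (1 / (?se + ?s)) *\<^sub>R (?ye + ?y)"
      by (subst x_of_Edge) (auto simp: F')
    show ?thesis
    proof (cases "?se = 0")
      case True
      then have "x_of T (Edge e) = x_of S (Node i)" using xT xi se by simp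
      then show ?thesis using True sT \<delta> F' by simp
    next
      case False
      then have se0: "?se > 0" using se by simp
      have "merge_loss ?ye ?se ?y ?s \<le> (\<Sum>e\<in>{e\<in>parcs G. fst e = i}. merge_loss (y_of S (Edge e)) (s_of S (Edge e)) ?y ?s)"
        by (rule member_le_sum) (use e adm s in \<open>auto intro!: merge_loss_nonneg simp: admissible_def\<close>)
      also have "\<dots> \<le> \<eta> / 4 * \<delta>\<^sup>2"
        using energy_A[OF adm i] le by (simp add: T d_def)
      finally have "\<eta> / 4 * (norm ((1 / ?se) *\<^sub>R ?ye - (1 / ?s) *\<^sub>R ?y))\<^sup>2 \<le> \<eta> / 4 * \<delta>\<^sup>2"
        using merge_loss_ge[OF \<eta>, of ?se ?s ?ye ?y] mS e False s\<eta> by (fastforce simp: mass_at_least_def)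
      then have n: "norm ((1 / ?se) *\<^sub>R ?ye - (1 / ?s) *\<^sub>R ?y) \<le> \<delta>"
        by (rule sq_bound_imp_le[OF \<eta> \<delta>])
      have "dist (x_of S (Edge e)) (x_of T (Edge e)) \<le> \<delta>"
        using merged_position[OF se0 s, of ?ye ?y] n False
        by (simp add: xT x_of_Edge dist_norm norm_minus_commute)
      moreover have "dist (x_of S (Node i)) (x_of T (Edge e)) \<le> \<delta>"
        using merged_position[OF s se0, of ?y ?ye] n
        unfolding xT dist_norm xi[symmetric] by (simp only: norm_minus_commute add.commute)
      ultimately show ?thesis using sT F' by simp
    qed
  qed
  have "dist (x_of S (Edge e)) (x_of T (Edge e)) = 0 \<and> s_of T (Edge e) = s_of S (Edge e)"
    if "fst e \<noteq> i" "s_of S (Edge e) > 0" for e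
    using that by (simp add: x_of_Edge F)
  then have "s_of T (Edge e) > 0 \<and> dist (x_of S (Edge e)) (x_of T (Edge e)) \<le> \<delta>"
    if "e \<in> parcs G" "s_of S (Edge e) > 0" for e
    using edge[OF that(1)] that(2) \<delta> by (cases "fst e = i") (simp_all del: x_of.simps)
  then show ?thesis using \<delta> edge unfolding small_step_def node by (auto simp del: x_of.simps)
qed

lemma small_step_B:
  assumes adm: "admissible S" and e: "(i, j) \<in> parcs G" and T: "T = do_B i j S"
    and mS: "mass_at_least \<eta> S" and \<eta>: "\<eta> > 0" and \<delta>: "\<delta> \<ge> 0"
    and le: "total_energy S \<le> total_energy T + \<eta> / 4 * \<delta>\<^sup>2"
  shows "small_step \<delta> (OpB (i, j)) S T"
proof -
  note F = do_B_fields[of i j S, folded T]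
  let ?ye = "y_of S (Edge (i, j))" and ?se = "s_of S (Edge (i, j))"
  have j: "j \<in> pverts G" using e arc_ends by blast
  have s: "snode S j > 0" using adm j by (auto simp: admissible_def)
  have se: "?se \<ge> 0" "?se = 0 \<Longrightarrow> ?ye = 0" using adm e by (auto simp: admissible_def)
  have main: "dist (x_of S (Edge (i, j))) (x_of S (Node j)) \<le> \<delta> \<and> dist (x_of S (Node j)) (x_of T (Node j)) \<le> \<delta>"
    if se0: "?se > 0"
  proof -
    have "\<eta> / 4 * (norm ((1 / ?se) *\<^sub>R ?ye - (1 / snode S j) *\<^sub>R ynode S j))\<^sup>2
        \<le> merge_loss ?ye ?se (ynode S j) (snode S j)"
      using mS e j se0 by (intro merge_loss_ge[OF \<eta>]) (auto simp: mass_at_least_def)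
    also have "\<dots> \<le> \<eta> / 4 * \<delta>\<^sup>2" using energy_B[OF adm e] le by (simp add: T)
    finally have n: "norm ((1 / ?se) *\<^sub>R ?ye - (1 / snode S j) *\<^sub>R ynode S j) \<le> \<delta>"
      by (rule sq_bound_imp_le[OF \<eta> \<delta>])
    have "dist (x_of S (Edge (i, j))) (x_of S (Node j)) \<le> \<delta>"
      using n se0 by (simp add: x_of_Edge dist_norm)
    moreover have "x_of T (Node j) = (1 / (snode S j + ?se)) *\<^sub>R (ynode S j + ?ye)"
      by (simp add: F)
    then have "dist (x_of S (Node j)) (x_of T (Node j)) \<le> \<delta>"
      using merged_position[OF s se0, of "ynode S j" ?ye] n
      by (simp add: dist_norm norm_minus_commute)
    ultimately show ?thesis ..
  qed
  have "dist (x_of S (Node k)) (x_of T (Node k)) \<le> \<delta>" for k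
  proof (cases "k = j \<and> ?se > 0")
    case True then show ?thesis using main by blast
  next
    case False
    then have "x_of T (Node k) = x_of S (Node k)" using se by (auto simp: F)
    then show ?thesis using \<delta> by simp
  qed
  moreover have "s_of T (Edge e) = s_of S (Edge e) \<and> x_of T (Edge e) = x_of S (Edge e)"
    if "e \<noteq> (i, j)" "s_of S (Edge e) > 0" for e
    using that by (simp add: x_of_Edge F)
  ultimately show ?thesis using \<delta> main unfolding small_step_def by auto
qed

text \<open>
  If the objective drops by at most \<open>\<eta> / 4 * \<delta>^2\<close>, then so does the loss of this operation, which
  dominates \<open>\<eta> / 4\<close> times each squared displacement.
\<close>

lemma perform_small_step:
  assumes adm: "admissible S" and p: "p \<in> operations G" and perf: "perform G f V2 p S T"
    and mS: "mass_at_least \<eta> S" and mT: "mass_at_least \<eta> T" and \<eta>: "\<eta> > 0" and \<delta>: "\<delta> \<ge> 0"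
    and fin: "objective S \<noteq> \<infinity>"
    and le: "objective S \<le> objective T + ereal (\<eta> / 4 * \<delta>\<^sup>2)"
  shows "small_step \<delta> p S T"
proof -
  have energy_le: "total_energy S \<le> total_energy T + \<eta> / 4 * \<delta>\<^sup>2"
    if "zvec T = zvec S" "minorant T = minorant S"
  proof -
    have "(\<Sum>i\<in>pverts G. dual_value S i) \<noteq> -\<infinity>"
      by (rule sum_not_MInf) (use adm dual_value_not_MInf in auto)
    with fin le show ?thesis
      unfolding objective_same_dual[OF that] unfolding objective_eq
      by (cases "\<Sum>i\<in>pverts G. dual_value S i") auto
  qed
  show ?thesis
    using p
  proof (cases rule: operation_cases)
    case (1 i)
    then have T: "T = do_A G i S" using perf by simp
    have "total_energy S \<le> total_energy T + \<eta> / 4 * \<delta>\<^sup>2"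
      by (rule energy_le) (simp_all add: T do_A_fields)
    then show ?thesis using small_step_A[OF adm 1(2) T mS mT \<eta> \<delta>] 1 by simp
  next
    case (2 i j)
    then have T: "T = do_B i j S" using perf by simp
    have "total_energy S \<le> total_energy T + \<eta> / 4 * \<delta>\<^sup>2"
      by (rule energy_le) (simp_all add: T do_B_fields)
    then show ?thesis using small_step_B[OF adm 2(2) T mS \<eta> \<delta>] 2 by simp
  next
    case (3 j)
    note C = perform_C_effect[OF adm 3(2) perf[unfolded 3(1)]]
    let ?d = "x_of T (Node j) - x_of S (Node j)"
    have "objective T \<noteq> -\<infinity>" "objective T \<noteq> \<infinity>"
      using objective_not_MInf[OF C(1)] perform_invariants(3)[OF adm p perf] fin by auto
    then have "snode S j / 2 * (norm ?d)\<^sup>2 \<le> \<eta> / 4 * \<delta>\<^sup>2"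
      using order_trans[OF C(3) le] by (cases "objective T") (auto simp del: x_of.simps)
    moreover have "\<eta> / 4 * (norm ?d)\<^sup>2 \<le> snode S j / 2 * (norm ?d)\<^sup>2"
      using mS \<eta> 3(2) by (intro mult_right_mono) (force simp: mass_at_least_def)+
    ultimately have n: "norm ?d \<le> \<delta>" using sq_bound_imp_le[OF \<eta> \<delta>] by (meson order_trans)
    have "dist (x_of S (Node k)) (x_of T (Node k)) \<le> \<delta>" for k
    proof (cases "k = j")
      case True then show ?thesis using n by (simp add: dist_norm norm_minus_commute del: x_of.simps)
    next
      case False then show ?thesis using C(4) C(10)[OF False] \<delta> by simp
    qed
    moreover have "s_of T (Edge e) = s_of S (Edge e)" "y_of T (Edge e) = y_of S (Edge e)" for e
      by (simp_all add: s_of_Edge y_of_Edge C)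
    then have "x_of T (Edge e) = x_of S (Edge e)" "s_of T (Edge e) = s_of S (Edge e)" if "s_of S (Edge e) > 0" for e
      using that by (simp_all add: x_of_Edge)
    ultimately show ?thesis using \<delta> unfolding small_step_def 3(1) by simp
  qed
qed

text \<open>
  The remaining operations \<open>ps\<close> lower the objective by so little that none of them moves a component
  by more than \<open>\<delta>\<close>.  The power of \<open>dilution\<close> is the reserve that keeps all positive masses at
  least \<open>\<eta>\<close> until the end.
\<close>

definition controlled ::
  "real \<Rightarrow> real \<Rightarrow> 'v operation list \<Rightarrow> ('v, 'm) state \<Rightarrow> ('v, 'm) state \<Rightarrow> bool" where
  "controlled \<eta> \<delta> ps S S' \<longleftrightarrow>
     admissible S \<and> set ps \<subseteq> operations G \<and> perform_list G f V2 ps S S' \<and>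
     mass_at_least (\<eta> * dilution ^ length ps) S \<and> objective S \<noteq> \<infinity> \<and>
     objective S \<le> objective S' + ereal (\<eta> / 4 * \<delta>\<^sup>2)"

lemma controlled_Cons:
  assumes "controlled \<eta> \<delta> (p # ps) S S'" and \<eta>: "\<eta> > 0" and \<delta>: "\<delta> \<ge> 0"
  obtains T where "small_step \<delta> p S T" "controlled \<eta> \<delta> ps T S'"
proof -
  obtain T where T: "perform G f V2 p S T" "perform_list G f V2 ps T S'"
    and adm: "admissible S" and p: "p \<in> operations G" and ps: "set ps \<subseteq> operations G"
    and mass: "mass_at_least (\<eta> * dilution ^ length ps * dilution) S"
    and fin: "objective S \<noteq> \<infinity>" and le: "objective S \<le> objective S' + ereal (\<eta> / 4 * \<delta>\<^sup>2)"
    using assms(1) by (auto simp: controlled_def mult_ac)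
  note I = perform_invariants[OF adm p T(1)]
  have pow: "1 \<le> dilution ^ n" for n using dilution_ge by (simp add: one_le_power)
  have pos: "0 < \<eta> * dilution ^ length ps"
    using \<eta> pow[of "length ps"] by (intro mult_pos_pos) auto
  have mT: "mass_at_least (\<eta> * dilution ^ length ps) T"
    by (rule perform_mass[OF adm p T(1) mass pos])
  have mle: "\<eta> \<le> \<eta> * dilution ^ length ps" using \<eta> pow[of "length ps"] by simp
  have "\<eta> \<le> \<eta> * dilution ^ length ps * dilution" using \<eta> pow[of "Suc (length ps)"] by (simp add: mult_ac)
  then have mS: "mass_at_least \<eta> S" by (rule mass_at_least_mono[OF mass])
  have le': "objective S' \<le> objective T" using perform_list_invariants[OF I(1) ps T(2)] by blast
  show ?thesis
  proof
    have "objective S \<le> objective T + ereal (\<eta> / 4 * \<delta>\<^sup>2)"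
      using le add_right_mono[OF le'] by (rule order_trans)
    then show "small_step \<delta> p S T"
      by (rule perform_small_step[OF adm p T(1) mS mass_at_least_mono[OF mT mle] \<eta> \<delta> fin])
    show "controlled \<eta> \<delta> ps T S'"
      using I ps T(2) mT fin le unfolding controlled_def by auto
  qed
qed

text \<open>
  Positive mass on an edge has to be delivered by the next Operation B on it.  The delivery is short,
  and until then both the edge component and the head move by at most \<open>\<delta>\<close> per operation.
\<close>

lemma edge_near_head:
  assumes "controlled \<eta> \<delta> ps S S'" and "\<eta> > 0" "\<delta> \<ge> 0"
    and e: "(i, j) \<in> parcs G" and "OpB (i, j) \<in> set ps" and "s_of S (Edge (i, j)) > 0"
  shows "dist (x_of S (Edge (i, j))) (x_of S (Node j)) \<le> 2 * real (length ps) * \<delta>"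
  using assms(1,5,6)
proof (induction ps arbitrary: S)
  case (Cons p ps)
  have j: "j \<in> pverts G" using e arc_ends by blast
  obtain T where T: "small_step \<delta> p S T" "controlled \<eta> \<delta> ps T S'"
    using controlled_Cons[OF Cons.prems(1) assms(2,3)] by blast
  show ?case
  proof (cases "p = OpB (i, j)")
    case True
    then have "dist (x_of S (Edge (i, j))) (x_of S (Node j)) \<le> \<delta>"
      using T(1) Cons.prems(3) unfolding small_step_def by blast
    also have "\<delta> \<le> 2 * real (length (p # ps)) * \<delta>"
      using mult_right_mono[of 1 "2 * real (length (p # ps))" \<delta>] assms(3) by simp
    finally show ?thesis .
  next
    case False
    then have "dist (x_of S (Edge (i, j))) (x_of T (Edge (i, j))) \<le> \<delta>" "s_of T (Edge (i, j)) > 0"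
      "dist (x_of S (Node j)) (x_of T (Node j)) \<le> \<delta>"
      using T(1) Cons.prems(3) e j unfolding small_step_def by blast+
    moreover have "dist (x_of T (Edge (i, j))) (x_of T (Node j)) \<le> 2 * real (length ps) * \<delta>"
      by (rule Cons.IH[OF T(2)]) (use Cons.prems False calculation in auto)
    ultimately show ?thesis
      using dist_triangle[of "x_of S (Edge (i, j))" "x_of S (Node j)" "x_of T (Edge (i, j))"]
        dist_triangle2[of "x_of T (Edge (i, j))" "x_of S (Node j)" "x_of T (Node j)"]
      by (simp add: algebra_simps del: x_of.simps)
  qed
qed simp

text \<open>
  Operation A leaves mass on the edge close to its tail, and this mass is delivered close to its head.
\<close>

lemma tail_near_head:
  assumes "controlled \<eta> \<delta> ps S S'" and "\<eta> > 0" "\<delta> \<ge> 0"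
    and e: "(i, j) \<in> parcs G" and "ps = ps1 @ OpA i # ps2" "OpB (i, j) \<in> set ps2"
  shows "dist (x_of S (Node i)) (x_of S (Node j)) \<le> 2 * real (length ps) * \<delta>"
  using assms(1,5)
proof (induction ps1 arbitrary: S ps)
  case Nil
  have ij: "i \<in> pverts G" "j \<in> pverts G" using e arc_ends by force+
  obtain T where T: "small_step \<delta> (OpA i) S T" "controlled \<eta> \<delta> ps2 T S'"
    using controlled_Cons[OF Nil(1)[unfolded Nil(2) append_Nil] assms(2,3)] by blast
  have "s_of T (Edge (i, j)) > 0" "dist (x_of S (Node i)) (x_of T (Edge (i, j))) \<le> \<delta>"
    "dist (x_of S (Node j)) (x_of T (Node j)) \<le> \<delta>"
    using T(1) e ij unfolding small_step_def by force+
  moreover have "dist (x_of T (Edge (i, j))) (x_of T (Node j)) \<le> 2 * real (length ps2) * \<delta>"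
    by (rule edge_near_head[OF T(2) assms(2,3) e assms(6)]) (rule calculation)
  ultimately show ?case
    using dist_triangle[of "x_of S (Node i)" "x_of S (Node j)" "x_of T (Edge (i, j))"]
      dist_triangle2[of "x_of T (Edge (i, j))" "x_of S (Node j)" "x_of T (Node j)"] Nil(2)
    by (simp add: algebra_simps del: x_of.simps)
next
  case (Cons p qs)
  have ij: "i \<in> pverts G" "j \<in> pverts G" using e arc_ends by force+
  obtain T where T: "small_step \<delta> p S T" "controlled \<eta> \<delta> (qs @ OpA i # ps2) T S'"
    using controlled_Cons[OF Cons.prems(1)[unfolded Cons.prems(2) append_Cons] assms(2,3)] by blast
  have "dist (x_of S (Node i)) (x_of T (Node i)) \<le> \<delta>" "dist (x_of S (Node j)) (x_of T (Node j)) \<le> \<delta>"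
    using T(1) ij unfolding small_step_def by blast+
  moreover note Cons.IH[OF T(2) refl]
  ultimately show ?case
    using dist_triangle[of "x_of S (Node i)" "x_of S (Node j)" "x_of T (Node i)"]
      dist_triangle2[of "x_of T (Node i)" "x_of S (Node j)" "x_of T (Node j)"] Cons.prems(2)
    by (simp add: algebra_simps del: x_of.simps)
qed

section \<open>Weak duality\<close>

text \<open>
  Test every conjugate with the vector all of whose components equal \<open>x\<close>.  It lies in each coupling
  space, so the coupling blocks are orthogonal to it and drop out.
\<close>

lemma weak_duality:
  assumes F: "\<And>i. i \<in> pverts G \<Longrightarrow> f i x = ereal (F i)"
  shows "ereal (node_count * (mean_vec G xbar \<bullet> x) - node_count / 2 * (norm x)\<^sup>2 - (\<Sum>i\<in>pverts G. F i))
           \<le> dual_opt G f xbar"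
  unfolding dual_opt_def
proof (rule INF_greatest)
  fix z :: "'v block \<Rightarrow> 'v comp \<Rightarrow> real^'m"
  let ?m = "mean_vec G xbar"
  define c where "c = restrict (\<lambda>_. x) (comps G)"
  have c: "c \<in> prod_space G" by (simp add: c_def prod_space_def)
  have inner: "prod_inner G c w = (\<Sum>\<alpha>\<in>comps G. x \<bullet> w \<alpha>)" for w
    by (simp add: prod_inner_def c_def)
  have fin: "finite (couplings G)" by (simp add: couplings_def)
  have coupl: "\<beta> \<subseteq> comps G" if mem: "\<beta> \<in> couplings G" for \<beta>
  proof -
    obtain i j where "(i, j) \<in> parcs G" "\<beta> = {Node i, Edge (i, j)} \<or> \<beta> = {Node i, Node j}"
      using mem by (auto simp: couplings_def)
    then show ?thesis using in_arcsD1[of i j] in_arcsD2[of i j] by (auto simp: comps_def)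
  qed
  define w where "w \<alpha> = (\<Sum>b\<in>blocks G. z b \<alpha>)" for \<alpha>
  have w: "w \<alpha> = (\<Sum>i\<in>pverts G. z (FunBlock i) \<alpha>) + (\<Sum>\<beta>\<in>couplings G. z (CouplingBlock \<beta>) \<alpha>)" for \<alpha>
    unfolding w_def blocks_def using fin
    by (subst sum.union_disjoint) (auto simp: sum.reindex inj_on_def)
  have fun_part: "(\<Sum>i\<in>pverts G. ereal ((\<Sum>\<alpha>\<in>comps G. x \<bullet> z (FunBlock i) \<alpha>) - F i))
      \<le> (\<Sum>i\<in>pverts G. prod_conjugate G (\<lambda>x. f i (x (Node i))) (z (FunBlock i)))"
  proof (rule sum_mono)
    fix i assume i: "i \<in> pverts G"
    then have "c (Node i) = x" by (simp add: c_def comps_def)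
    then show "ereal ((\<Sum>\<alpha>\<in>comps G. x \<bullet> z (FunBlock i) \<alpha>) - F i)
        \<le> prod_conjugate G (\<lambda>x. f i (x (Node i))) (z (FunBlock i))"
      unfolding prod_conjugate_def by (intro SUP_upper2[OF c]) (simp add: inner F[OF i])
  qed
  have coupling_part: "(\<Sum>\<beta>\<in>couplings G. ereal (\<Sum>\<alpha>\<in>comps G. x \<bullet> z (CouplingBlock \<beta>) \<alpha>))
      \<le> (\<Sum>\<beta>\<in>couplings G. set_indicator (prod_orthogonal G (coupling_space G \<beta>)) (z (CouplingBlock \<beta>)))"
  proof (rule sum_mono)
    fix \<beta> assume \<beta>: "\<beta> \<in> couplings G"
    have "c \<in> coupling_space G \<beta>"
      using c coupl[OF \<beta>] by (auto simp: coupling_space_def c_def)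
    then show "ereal (\<Sum>\<alpha>\<in>comps G. x \<bullet> z (CouplingBlock \<beta>) \<alpha>)
        \<le> set_indicator (prod_orthogonal G (coupling_space G \<beta>)) (z (CouplingBlock \<beta>))"
      by (auto simp: set_indicator_def prod_orthogonal_def inner[symmetric])
  qed
  have quad_part: "(\<Sum>\<alpha>\<in>comps G. ereal (initial_mass \<alpha> * (?m \<bullet> x) - x \<bullet> w \<alpha> - initial_mass \<alpha> / 2 * (norm x)\<^sup>2))
      \<le> (\<Sum>\<alpha>\<in>comps G. quad_term (initial_mass \<alpha>) ?m (w \<alpha>))"
  proof (rule sum_mono)
    fix \<alpha> :: "'v comp"
    have "initial_mass \<alpha> \<ge> 0" by (cases \<alpha>) auto
    then show "ereal (initial_mass \<alpha> * (?m \<bullet> x) - x \<bullet> w \<alpha> - initial_mass \<alpha> / 2 * (norm x)\<^sup>2)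
        \<le> quad_term (initial_mass \<alpha>) ?m (w \<alpha>)" by (rule quad_term_ge)
  qed
  have mass: "(\<Sum>\<alpha>\<in>comps G. initial_mass \<alpha>) = node_count"
    by (simp add: sum_comps node_count_def)
  have "(\<Sum>\<alpha>\<in>comps G. x \<bullet> w \<alpha>) = (\<Sum>i\<in>pverts G. \<Sum>\<alpha>\<in>comps G. x \<bullet> z (FunBlock i) \<alpha>)
      + (\<Sum>\<beta>\<in>couplings G. \<Sum>\<alpha>\<in>comps G. x \<bullet> z (CouplingBlock \<beta>) \<alpha>)"
    unfolding w inner_add_right sum.distrib inner_sum_right
    by (intro arg_cong2[where f = "(+)"] sum.swap)
  moreover have "(\<Sum>\<alpha>\<in>comps G. initial_mass \<alpha> * (?m \<bullet> x) - x \<bullet> w \<alpha> - initial_mass \<alpha> / 2 * (norm x)\<^sup>2)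
      = node_count * (?m \<bullet> x) - (\<Sum>\<alpha>\<in>comps G. x \<bullet> w \<alpha>) - node_count / 2 * (norm x)\<^sup>2"
    by (simp only: sum_subtractf sum_distrib_right[symmetric] sum_divide_distrib[symmetric] mass)
  ultimately have "ereal (node_count * (?m \<bullet> x) - node_count / 2 * (norm x)\<^sup>2 - (\<Sum>i\<in>pverts G. F i))
      = (\<Sum>i\<in>pverts G. ereal ((\<Sum>\<alpha>\<in>comps G. x \<bullet> z (FunBlock i) \<alpha>) - F i))
      + (\<Sum>\<beta>\<in>couplings G. ereal (\<Sum>\<alpha>\<in>comps G. x \<bullet> z (CouplingBlock \<beta>) \<alpha>))
      + (\<Sum>\<alpha>\<in>comps G. ereal (initial_mass \<alpha> * (?m \<bullet> x) - x \<bullet> w \<alpha> - initial_mass \<alpha> / 2 * (norm x)\<^sup>2))"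
    by (simp add: sum_subtractf)
  also have "\<dots> \<le> dual_objective G f xbar initial_mass z"
    unfolding dual_objective_def w_def[symmetric]
    by (intro add_mono fun_part coupling_part quad_part)
  finally show "ereal (node_count * (?m \<bullet> x) - node_count / 2 * (norm x)\<^sup>2 - (\<Sum>i\<in>pverts G. F i))
      \<le> dual_objective G f xbar initial_mass z" .
qed

text \<open>
  Add \<open>P x\<close> from weak duality to the objective: by conservation of momentum and mass the linear terms
  cancel, and the Fenchel-Young gaps and the squared distances to \<open>x\<close> are left.
\<close>

lemma duality_gap:
  assumes adm: "admissible T" and gap: "\<And>j. j \<in> pverts G \<Longrightarrow> gap_bound S T j"
    and mom: "momentum T = node_count *\<^sub>R mean_vec G xbar"
    and mass: "(\<Sum>\<alpha>\<in>comps G. s_of T \<alpha>) = node_count"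
  shows "objective T \<le> dual_opt G f xbar + ereal (
      (\<Sum>j\<in>pverts G. 2 / \<sigma> * ((norm (x - x_of T (Node j)))\<^sup>2
                               + (norm (x_of T (Node j) - x_of S (Node j)))\<^sup>2))
      + (\<Sum>\<alpha>\<in>comps G. s_of T \<alpha> / 2 * (norm (x - x_of T \<alpha>))\<^sup>2))"
    (is "_ \<le> _ + ereal (?A + ?B)")
proof -
  define \<kappa> where "\<kappa> j = real_of_ereal (dual_value T j)" for j
  define F where "F j = real_of_ereal (f j x)" for j
  have \<kappa>: "dual_value T j = ereal (\<kappa> j)" and F: "f j x = ereal (F j)"
    and le: "F j + \<kappa> j - zvec T j \<bullet> x
        \<le> 2 / \<sigma> * ((norm (x - x_of T (Node j)))\<^sup>2 + (norm (x_of T (Node j) - x_of S (Node j)))\<^sup>2)"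
    if j: "j \<in> pverts G" for j
  proof -
    obtain k where k: "dual_value T j = ereal k" "\<forall>x. \<exists>F. f j x = ereal F \<and>
          F + k - zvec T j \<bullet> x
            \<le> 2 / \<sigma> * ((norm (x - x_of T (Node j)))\<^sup>2 + (norm (x_of T (Node j) - x_of S (Node j)))\<^sup>2)"
      using gap[OF j] unfolding gap_bound_def by blast
    obtain F' where F': "f j x = ereal F'" "F' + k - zvec T j \<bullet> x
            \<le> 2 / \<sigma> * ((norm (x - x_of T (Node j)))\<^sup>2 + (norm (x_of T (Node j) - x_of S (Node j)))\<^sup>2)"
      using k(2) by blast
    have [simp]: "\<kappa> j = k" "F j = F'" by (simp_all add: \<kappa>_def F_def k(1) F'(1))
    show "dual_value T j = ereal (\<kappa> j)" "f j x = ereal (F j)" by (simp_all add: k F')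
    show "F j + \<kappa> j - zvec T j \<bullet> x
        \<le> 2 / \<sigma> * ((norm (x - x_of T (Node j)))\<^sup>2 + (norm (x_of T (Node j) - x_of S (Node j)))\<^sup>2)"
      using F'(2) by (simp del: x_of.simps)
  qed
  have en: "energy (y_of T \<alpha>) (s_of T \<alpha>)
      = y_of T \<alpha> \<bullet> x - s_of T \<alpha> / 2 * (norm x)\<^sup>2 + s_of T \<alpha> / 2 * (norm (x - x_of T \<alpha>))\<^sup>2"
    if \<alpha>: "\<alpha> \<in> comps G" for \<alpha>
  proof -
    have s: "s_of T \<alpha> \<ge> 0" "s_of T \<alpha> = 0 \<Longrightarrow> y_of T \<alpha> = 0"
      using adm \<alpha> by (force simp: admissible_def comps_def)+
    show ?thesis
    proof (cases "s_of T \<alpha> = 0")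
      case True then show ?thesis using s by (simp add: energy_def)
    next
      case False
      then have "x_of T \<alpha> = (1 / s_of T \<alpha>) *\<^sub>R y_of T \<alpha>" by (cases \<alpha>) (auto simp: x_of_Edge)
      then show ?thesis using energy_square[OF s, of x] by simp
    qed
  qed
  have "(\<Sum>\<alpha>\<in>comps G. y_of T \<alpha> \<bullet> x) + (\<Sum>j\<in>pverts G. zvec T j \<bullet> x) = momentum T \<bullet> x"
    by (simp add: momentum_def inner_add_left inner_sum_left)
  then have mom': "(\<Sum>\<alpha>\<in>comps G. y_of T \<alpha> \<bullet> x) = node_count * (mean_vec G xbar \<bullet> x) - (\<Sum>j\<in>pverts G. zvec T j \<bullet> x)"
    by (simp add: mom)
  have "total_energy T = (\<Sum>\<alpha>\<in>comps G. y_of T \<alpha> \<bullet> x) - (\<Sum>\<alpha>\<in>comps G. s_of T \<alpha>) / 2 * (norm x)\<^sup>2 + ?B"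
    unfolding total_energy_def
    by (simp add: en sum.distrib sum_subtractf sum_distrib_right sum_divide_distrib del: x_of.simps)
  then have E: "total_energy T = node_count * (mean_vec G xbar \<bullet> x) - (\<Sum>j\<in>pverts G. zvec T j \<bullet> x)
      - node_count / 2 * (norm x)\<^sup>2 + ?B"
    unfolding mom' mass .
  have "(\<Sum>j\<in>pverts G. F j + \<kappa> j - zvec T j \<bullet> x) \<le> ?A" by (rule sum_mono) (rule le)
  then have "(\<Sum>j\<in>pverts G. \<kappa> j) + total_energy T
      \<le> (node_count * (mean_vec G xbar \<bullet> x) - node_count / 2 * (norm x)\<^sup>2 - (\<Sum>j\<in>pverts G. F j)) + (?A + ?B)"
    unfolding E by (simp add: sum.distrib sum_subtractf del: x_of.simps)
  then have "objective T \<le> ereal (node_count * (mean_vec G xbar \<bullet> x) - node_count / 2 * (norm x)\<^sup>2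
      - (\<Sum>j\<in>pverts G. F j)) + ereal (?A + ?B)"
    unfolding objective_eq by (simp add: \<kappa> del: x_of.simps)
  also have "\<dots> \<le> dual_opt G f xbar + ereal (?A + ?B)"
    by (rule add_right_mono, rule weak_duality) (rule F)
  finally show ?thesis .
qed

section \<open>The contraction estimate\<close>

lemma gap_bound_cong:
  assumes "gap_bound S T j"
    and "ynode S' j = ynode S j" "snode S' j = snode S j"
    and "ynode T' j = ynode T j" "snode T' j = snode T j" "zvec T' j = zvec T j" "minorant T' j = minorant T j"
  shows "gap_bound S' T' j"
proof -
  have "x_of S' (Node j) = x_of S (Node j)" "x_of T' (Node j) = x_of T (Node j)"
    "dual_value T' j = dual_value T j"
    using assms(2-) by (simp_all add: dual_value_def)
  with assms(1,6) show ?thesis unfolding gap_bound_def by (simp only:)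
qed

text \<open>
  Operation C at \<open>j\<close> reads and writes only the data of \<open>j\<close>, so in a sweep each node behaves as if its
  step were the only one.
\<close>

lemma C_sweep:
  assumes "admissible S" "set ps \<subseteq> OpC ` pverts G" "distinct ps" "perform_list G f V2 ps S T"
  shows "snode T = snode S"
    and "OpC j \<notin> set ps \<Longrightarrow> ynode T j = ynode S j \<and> zvec T j = zvec S j \<and> minorant T j = minorant S j"
    and "OpC j \<in> set ps \<Longrightarrow> gap_bound S T j"
    and "OpC j \<in> set ps \<Longrightarrow>
      objective T + ereal (snode S j / 2 * (norm (x_of T (Node j) - x_of S (Node j)))\<^sup>2) \<le> objective S"
proof -
  let ?same = "\<lambda>S T j. ynode T j = ynode S j \<and> zvec T j = zvec S j \<and> minorant T j = minorant S j"
  let ?dec = "\<lambda>S T j. objective T + ereal (snode S j / 2 * (norm (x_of T (Node j) - x_of S (Node j)))\<^sup>2) \<le> objective S"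
  have "snode T = snode S \<and> (\<forall>j. (OpC j \<notin> set ps \<longrightarrow> ?same S T j) \<and>
      (OpC j \<in> set ps \<longrightarrow> gap_bound S T j \<and> ?dec S T j))"
    using assms
  proof (induction ps arbitrary: S)
    case (Cons p ps)
    then obtain k U where p: "p = OpC k" "k \<in> pverts G"
      and U: "perform G f V2 (OpC k) S U" "perform_list G f V2 ps U T" by auto
    note C = perform_C_effect[OF Cons.prems(1) p(2) U(1)]
    have pop: "OpC k \<in> operations G" and psop: "set ps \<subseteq> operations G"
      using p Cons.prems(2) by (auto simp: operations_def)
    have leUS: "objective U \<le> objective S" by (rule perform_invariants(3)[OF Cons.prems(1) pop U(1)])
    have leTU: "objective T \<le> objective U" using perform_list_invariants[OF C(1) psop U(2)] by blast
    have IH: "snode T = snode U" "\<And>j. OpC j \<notin> set ps \<Longrightarrow> ?same U T j"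
      "\<And>j. OpC j \<in> set ps \<Longrightarrow> gap_bound U T j" "\<And>j. OpC j \<in> set ps \<Longrightarrow> ?dec U T j"
      using Cons.IH[OF C(1) _ _ U(2)] Cons.prems by auto
    have s: "snode T = snode S" using IH(1) C(4) by simp
    show ?case
    proof (intro conjI allI impI)
      show "snode T = snode S" by (rule s)
    next
      fix j assume "OpC j \<notin> set (p # ps)"
      then have "j \<noteq> k" "OpC j \<notin> set ps" by (auto simp: p)
      then show "ynode T j = ynode S j" "zvec T j = zvec S j" "minorant T j = minorant S j"
        using IH(2) C(10) by simp_all
    next
      fix j assume j: "OpC j \<in> set (p # ps)"
      have "gap_bound S T j \<and> ?dec S T j"
      proof (cases "j = k")
        case True
        then have "OpC j \<notin> set ps" using Cons.prems(3) by (simp add: p)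
        from IH(2)[OF this] have same: "ynode T k = ynode U k" "zvec T k = zvec U k" "minorant T k = minorant U k"
          using True by auto
        have "gap_bound S T k" by (rule gap_bound_cong[OF C(2)]) (use same IH(1) in auto)
        moreover have "x_of T (Node k) = x_of U (Node k)" using same IH(1) by simp
        then have "?dec S T k"
          using order_trans[OF add_right_mono[OF leTU] C(3)] by (simp del: x_of.simps)
        ultimately show ?thesis using True by simp
      next
        case False
        then have j': "OpC j \<in> set ps" using j by (auto simp: p)
        have same: "ynode U j = ynode S j" using C(10)[OF False] by simp
        have "gap_bound S T j" by (rule gap_bound_cong[OF IH(3)[OF j']]) (use same C(4) in auto)
        moreover have "x_of U (Node j) = x_of S (Node j)" using same C(4) by simp
        then have "?dec S T j"
          using order_trans[OF IH(4)[OF j'] leUS] C(4) by (simp del: x_of.simps)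
        ultimately show ?thesis ..
      qed
      then show "gap_bound S T j" "?dec S T j" by blast+
    qed
  qed simp
  then show "snode T = snode S"
    "OpC j \<notin> set ps \<Longrightarrow> ?same S T j" "OpC j \<in> set ps \<Longrightarrow> gap_bound S T j" "OpC j \<in> set ps \<Longrightarrow> ?dec S T j"
    by blast+
qed

text \<open>
  \<open>\<eta>\<close> is the lower bound of the positive masses after \<open>L\<close> operations, and \<open>B\<close> bounds the disagreement of all
  positions in units of \<open>\<delta>\<close>.  The final \<open>1\<close> accounts for the decrease during the sweep itself.
\<close>

definition contraction_constant :: "real \<Rightarrow> nat \<Rightarrow> real \<Rightarrow> real" where
  "contraction_constant s L C =
     (let \<eta> = s / dilution ^ L; B = 2 * real L * (C + 1)
      in node_count * (2 / \<sigma>) * (4 * B\<^sup>2 / \<eta> + 2 / s) + node_count / 2 * (4 * B\<^sup>2 / \<eta>) + 1)"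

text \<open>
  \<open>S\<close> and \<open>T\<close> are the states before and after the sweep of Operation C, and \<open>ps\<close> leads from \<open>T\<close> to the
  last state \<open>U\<close>.  The gap at \<open>T\<close> is evaluated at the position of an arbitrary node \<open>u\<close>.
\<close>

lemma gap_le_decrease:
  assumes adm: "admissible S" and mom: "momentum S = node_count *\<^sub>R mean_vec G xbar"
    and sweep: "set qs = OpC ` pverts G" "distinct qs" "perform_list G f V2 qs S T"
    and tail: "set ps \<subseteq> operations G" "perform_list G f V2 ps T U" and len: "length ps \<le> L"
    and comm: "\<And>i j. (i, j) \<in> parcs G \<Longrightarrow> \<exists>ps1 ps2. ps = ps1 @ OpA i # ps2 \<and> OpB (i, j) \<in> set ps2"
    and mass: "mass_at_least s S" "mass_at_least s T" and s: "s > 0"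
    and total: "(\<Sum>\<alpha>\<in>comps G. s_of T \<alpha>) = node_count"
    and C: "C \<ge> 0"
      "\<And>(x :: 'v \<Rightarrow> real^'m) \<delta> u v.
       \<lbrakk>\<delta> \<ge> 0; \<forall>(i, j)\<in>parcs G. dist (x i) (x j) \<le> \<delta>; u \<in> pverts G; v \<in> pverts G\<rbrakk>
       \<Longrightarrow> dist (x u) (x v) \<le> C * \<delta>"
    and nonempty: "u \<in> pverts G"
    and A0: "objective S = ereal a0"
  obtains aK where "objective U = ereal aK" "aK \<le> a0"
    "ereal a0 \<le> dual_opt G f xbar + ereal (contraction_constant s L C * (a0 - aK))"
proof -
  have qs: "set qs \<subseteq> operations G" using sweep(1) by (auto simp: operations_def)
  note I1 = perform_list_invariants[OF adm qs sweep(3)]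
  note I2 = perform_list_invariants[OF conjunct1[OF I1] tail]
  note W = C_sweep[OF adm equalityD1[OF sweep(1)] sweep(2,3)]
  have admT: "admissible T" and momT: "momentum T = node_count *\<^sub>R mean_vec G xbar"
    and admU: "admissible U" and dec: "objective T \<le> objective S" "objective U \<le> objective T"
    using I1 I2 mom by auto
  obtain a1 where A1: "objective T = ereal a1"
    using dec(1) objective_not_MInf[OF admT] A0 by (cases "objective T") auto
  obtain aK where AK: "objective U = ereal aK"
    using dec(2) objective_not_MInf[OF admU] A1 by (cases "objective U") auto
  have le: "aK \<le> a1" "a1 \<le> a0" using dec A0 A1 AK by auto
  define \<eta> where "\<eta> = s / dilution ^ L"
  define B where "B = 2 * real L * (C + 1)"
  have dil: "dilution ^ n > 0" for n using dilution_ge by (simp add: order_less_le_trans[OF zero_less_one])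
  have \<eta>: "\<eta> > 0" using s dil by (simp add: \<eta>_def)
  \<comment> \<open>chosen such that the decrease from \<open>T\<close> to \<open>U\<close> equals \<open>\<eta> / 4 * \<delta>^2\<close>\<close>
  define \<delta> where "\<delta> = sqrt (4 * (a1 - aK) / \<eta>)"
  have \<delta>: "\<delta> \<ge> 0" "\<delta>\<^sup>2 = 4 * (a1 - aK) / \<eta>" using le \<eta> by (simp_all add: \<delta>_def)
  have ctrl: "controlled \<eta> \<delta> ps T U"
    unfolding controlled_def
  proof (intro conjI)
    have "\<eta> * dilution ^ length ps \<le> \<eta> * dilution ^ L"
      using \<eta> len dilution_ge by (intro mult_left_mono power_increasing) auto
    also have "\<dots> = s" using dil[of 1] by (simp add: \<eta>_def)
    finally show "mass_at_least (\<eta> * dilution ^ length ps) T" by (rule mass_at_least_mono[OF mass(2)])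
    show "objective T \<le> objective U + ereal (\<eta> / 4 * \<delta>\<^sup>2)"
    proof -
      have "\<eta> / 4 * \<delta>\<^sup>2 = a1 - aK" using \<eta> by (simp add: \<delta>(2) field_simps)
      then have "a1 \<le> aK + \<eta> / 4 * \<delta>\<^sup>2" by linarith
      then show ?thesis unfolding A1 AK by (simp only: plus_ereal.simps ereal_less_eq)
    qed
  qed (use admT tail A1 in auto)
  have len\<delta>: "2 * real (length ps) * \<delta> \<le> 2 * real L * \<delta>"
    using len \<delta>(1) by (intro mult_right_mono) auto
  have arcs: "dist (x_of T (Node i)) (x_of T (Node j)) \<le> 2 * real L * \<delta>" if e: "(i, j) \<in> parcs G" for i j
  proof -
    obtain ps1 ps2 where "ps = ps1 @ OpA i # ps2" "OpB (i, j) \<in> set ps2" using comm[OF e] by blast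
    from order_trans[OF tail_near_head[OF ctrl \<eta> \<delta>(1) e this] len\<delta>] show ?thesis .
  qed
  have "dist (x_of T (Node i)) (x_of T (Node u)) \<le> C * (2 * real L * \<delta>)" if "i \<in> pverts G" for i
    by (rule C(2)[of "2 * real L * \<delta>" "\<lambda>i. x_of T (Node i)"]) (use arcs that nonempty \<delta> in auto)
  then have node: "dist (x_of T (Node i)) (x_of T (Node u)) \<le> C * (2 * real L * \<delta>)"
    if "i \<in> pverts G" for i using that by blast
  have B: "C * (2 * real L * \<delta>) \<le> B * \<delta>" "C * (2 * real L * \<delta>) + 2 * real L * \<delta> = B * \<delta>"
    using \<delta>(1) by (simp_all add: B_def algebra_simps)
  let ?x = "x_of T (Node u)"
  have near: "s_of T \<alpha> / 2 * (norm (?x - x_of T \<alpha>))\<^sup>2 \<le> s_of T \<alpha> / 2 * (B * \<delta>)\<^sup>2" if \<alpha>: "\<alpha> \<in> comps G" for \<alpha>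
  proof (cases "s_of T \<alpha> = 0")
    case False
    then have sp: "s_of T \<alpha> > 0" using \<alpha> admT by (force simp: admissible_def comps_def)
    have "dist (x_of T \<alpha>) ?x \<le> B * \<delta>"
    proof (cases \<alpha>)
      case (Node i)
      then have "i \<in> pverts G" using \<alpha> by (auto simp: comps_def)
      then show ?thesis using order_trans[OF node B(1)] Node by blast
    next
      case (Edge e)
      obtain i j where ij: "e = (i, j)" by (cases e)
      have e: "(i, j) \<in> parcs G" using \<alpha> Edge ij by (auto simp: comps_def)
      have "OpB (i, j) \<in> set ps" using comm[OF e] by auto
      then have "dist (x_of T (Edge (i, j))) (x_of T (Node j)) \<le> 2 * real (length ps) * \<delta>"
        using sp Edge ij by (intro edge_near_head[OF ctrl \<eta> \<delta>(1) e]) auto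
      moreover have "dist (x_of T (Node j)) ?x \<le> C * (2 * real L * \<delta>)"
        using e arc_ends by (intro node) blast
      ultimately show ?thesis
        using dist_triangle[of "x_of T (Edge (i, j))" ?x "x_of T (Node j)"] len\<delta> B(2) Edge ij
        by (simp del: x_of.simps)
    qed
    then have "(norm (?x - x_of T \<alpha>))\<^sup>2 \<le> (B * \<delta>)\<^sup>2"
      by (intro power_mono) (simp_all add: dist_norm norm_minus_commute del: x_of.simps)
    then show ?thesis using sp by (intro mult_left_mono) auto
  qed simp
  have move: "(norm (x_of T (Node j) - x_of S (Node j)))\<^sup>2 \<le> 2 * (a0 - a1) / s" if j: "j \<in> pverts G" for j
  proof -
    let ?d = "(norm (x_of T (Node j) - x_of S (Node j)))\<^sup>2"
    have "OpC j \<in> set qs" using sweep(1) j by auto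
    from W(4)[OF this] have "snode S j / 2 * ?d \<le> a0 - a1"
      by (simp add: A0 A1 del: x_of.simps)
    moreover have "s / 2 * ?d \<le> snode S j / 2 * ?d"
      using mass(1) j by (intro mult_right_mono) (auto simp: mass_at_least_def)
    ultimately show ?thesis using s by (simp add: field_simps del: x_of.simps)
  qed
  let ?Q = "(B * \<delta>)\<^sup>2"
  have nodeQ: "(norm (?x - x_of T (Node j)))\<^sup>2 \<le> ?Q" if "j \<in> pverts G" for j
    using order_trans[OF node[OF that] B(1)]
    by (intro power_mono) (simp_all add: dist_norm norm_minus_commute del: x_of.simps)
  have sumA: "(\<Sum>j\<in>pverts G. 2 / \<sigma> * ((norm (?x - x_of T (Node j)))\<^sup>2
                               + (norm (x_of T (Node j) - x_of S (Node j)))\<^sup>2))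
      \<le> node_count * (2 / \<sigma> * (?Q + 2 * (a0 - a1) / s))"
    unfolding node_count_def using \<sigma>_pos
    by (intro sum_bounded_above mult_left_mono add_mono nodeQ move) auto
  have "(\<Sum>\<alpha>\<in>comps G. s_of T \<alpha> / 2 * (norm (?x - x_of T \<alpha>))\<^sup>2) \<le> (\<Sum>\<alpha>\<in>comps G. s_of T \<alpha> / 2 * ?Q)"
    by (rule sum_mono) (rule near)
  also have "\<dots> = node_count / 2 * ?Q"
    by (simp only: sum_distrib_right[symmetric] sum_divide_distrib[symmetric] total)
  finally have sumB: "(\<Sum>\<alpha>\<in>comps G. s_of T \<alpha> / 2 * (norm (?x - x_of T \<alpha>))\<^sup>2) \<le> node_count / 2 * ?Q" .
  define D where "D = a0 - aK"
  have Q: "?Q \<le> 4 * B\<^sup>2 / \<eta> * D"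
  proof -
    have "?Q = 4 * B\<^sup>2 / \<eta> * (a1 - aK)" by (simp add: power_mult_distrib \<delta>(2))
    also have "\<dots> \<le> 4 * B\<^sup>2 / \<eta> * D" using le \<eta> by (intro mult_left_mono) (auto simp: D_def)
    finally show ?thesis .
  qed
  have M: "2 * (a0 - a1) / s \<le> 2 / s * D"
    using le s by (simp add: D_def divide_right_mono)
  have n: "node_count \<ge> 0" by (simp add: node_count_def)
  have "node_count * (2 / \<sigma> * (?Q + 2 * (a0 - a1) / s)) \<le> node_count * (2 / \<sigma> * (4 * B\<^sup>2 / \<eta> * D + 2 / s * D))"
    using n \<sigma>_pos by (intro mult_left_mono add_mono Q M) auto
  moreover have "node_count / 2 * ?Q \<le> node_count / 2 * (4 * B\<^sup>2 / \<eta> * D)"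
    using n by (intro mult_left_mono Q) auto
  moreover have "a0 - a1 \<le> D" using le by (simp add: D_def)
  moreover have "node_count * (2 / \<sigma> * (4 * B\<^sup>2 / \<eta> * D + 2 / s * D)) + node_count / 2 * (4 * B\<^sup>2 / \<eta> * D) + D
      = contraction_constant s L C * D"
    unfolding contraction_constant_def Let_def \<eta>_def[symmetric] B_def[symmetric]
    by (simp add: algebra_simps)
  ultimately have bound: "(\<Sum>j\<in>pverts G. 2 / \<sigma> * ((norm (?x - x_of T (Node j)))\<^sup>2
                               + (norm (x_of T (Node j) - x_of S (Node j)))\<^sup>2))
      + (\<Sum>\<alpha>\<in>comps G. s_of T \<alpha> / 2 * (norm (?x - x_of T \<alpha>))\<^sup>2) + (a0 - a1)
      \<le> contraction_constant s L C * D"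
    using sumA sumB by linarith
  have gap: "gap_bound S T j" if "j \<in> pverts G" for j
    using W(3)[of j] sweep(1) that by auto
  from duality_gap[OF admT gap momT total, of ?x]
  have "ereal a0 \<le> dual_opt G f xbar + ereal (contraction_constant s L C * D)"
    unfolding A1 using bound by (cases "dual_opt G f xbar") (auto simp del: x_of.simps)
  then show ?thesis using that[OF AK] le by (simp add: D_def)
qed

text \<open>
  Needed when the objective is infinite before the sweep: the difference to the optimal value is then
  infinite too, provided that the latter is not \<open>-\<infinity>\<close>.
\<close>

lemma dual_opt_not_MInf:
  assumes "admissible S" and mom: "momentum S = node_count *\<^sub>R mean_vec G xbar"
    and sweep: "set qs = OpC ` pverts G" "distinct qs" "perform_list G f V2 qs S T"
    and total: "(\<Sum>\<alpha>\<in>comps G. s_of T \<alpha>) = node_count"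
  shows "dual_opt G f xbar \<noteq> -\<infinity>"
proof
  assume inf: "dual_opt G f xbar = -\<infinity>"
  have qs: "set qs \<subseteq> operations G" using sweep(1) by (auto simp: operations_def)
  note I = perform_list_invariants[OF assms(1) qs sweep(3)]
  have "gap_bound S T j" if "j \<in> pverts G" for j
    using C_sweep(3)[OF assms(1) equalityD1[OF sweep(1)] sweep(2,3), of j] sweep(1) that by auto
  from duality_gap[of T S xbar, OF _ this _ total, of 0] I mom inf
  have "objective T = -\<infinity>" by (simp del: x_of.simps)
  with objective_not_MInf I show False by blast
qed

lemma contraction_constant_ge:
  assumes "s > 0"
  shows "contraction_constant s L C \<ge> 1"
proof -
  have "dilution ^ L > 0" using dilution_ge by (simp add: order_less_le_trans[OF zero_less_one])
  then show ?thesis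
    using assms \<sigma>_pos unfolding contraction_constant_def Let_def node_count_def
    by (simp add: add_nonneg_nonneg)
qed

end

text \<open>
  The gap before is at most \<open>c\<close> times the decrease.  Enlarging \<open>c\<close> to \<open>c + 1\<close> keeps the factor positive.
\<close>

lemma contraction_from_gap:
  fixes opt :: ereal
  assumes "ereal a0 \<le> opt + ereal (c * (a0 - aK))" "c \<ge> 1" "aK \<le> a0"
  shows "ereal aK - opt \<le> ereal (1 - 1 / (c + 1)) * (ereal a0 - opt)"
proof (cases opt)
  case (real r)
  define d where "d = a0 - aK"
  have d: "d \<ge> 0" "a0 - r \<le> c * d" using assms real by (auto simp: d_def)
  then have "a0 - r \<le> (c + 1) * d" by (simp add: algebra_simps)
  then have "(a0 - r) / (c + 1) \<le> d" using assms(2) by (simp add: divide_le_eq mult.commute)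
  then have "aK - r \<le> (1 - 1 / (c + 1)) * (a0 - r)" by (simp add: d_def algebra_simps)
  then show ?thesis using real by simp
qed (use assms in auto)

theorem theorem3p4:
  fixes G :: "'v pair_pre_digraph"
    and f :: "'v \<Rightarrow> real^'m \<Rightarrow> ereal"
    and V1 V2 :: "'v set"
    and xbar :: "'v \<Rightarrow> real^'m"
    and \<sigma> s_min s_max :: real
    and K :: nat
  assumes "pair_fin_digraph G"
    and "strongly_connected (with_proj G)"
    and "V1 \<union> V2 = pverts G" and "V1 \<inter> V2 = {}"
    and "\<forall>i\<in>pverts G. proper_closed_convex (f i)"
    and "\<forall>i\<in>V2. \<forall>x. f i x \<noteq> \<infinity>"
    and "\<sigma> > 0" and "s_min > 0" and "s_max > 0" and "K > 0"
    and "\<forall>i\<in>pverts G. strongly_convex \<sigma> (conjugate (f i))"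
  shows "\<exists>\<gamma>::real. 0 < \<gamma> \<and> \<gamma> < 1 \<and>
    (\<forall>(st :: nat \<Rightarrow> ('v, 'm) state) (ops :: nat \<Rightarrow> 'v operation list) (N :: nat).
       algorithm_run G f V1 V2 xbar (N + K) st ops \<and>
       (\<forall>k\<le>K. (\<Sum>\<alpha>\<in>comps G. s_of (st (N + k)) \<alpha>) = real (card (pverts G)) \<and>
               (\<forall>i\<in>pverts G. s_of (st (N + k)) (Node i) > 0) \<and>
               (\<forall>e\<in>parcs G. s_of (st (N + k)) (Edge e) \<ge> 0)) \<and>
       (\<forall>k\<le>K. \<forall>\<alpha>\<in>comps G. s_of (st (N + k)) \<alpha> > 0 \<longrightarrow>
               s_min \<le> s_of (st (N + k)) \<alpha> \<and> s_of (st (N + k)) \<alpha> \<le> s_max) \<and>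
       distinct (ops N) \<and> set (ops N) = OpC ` pverts G \<and>
       (\<forall>(i, j)\<in>parcs G. \<exists>kbar\<in>{1..K - 1}.
               followed_by (OpA i) (OpB (i, j)) (ops (N + kbar)))
       \<longrightarrow>
       alg_objective G f V1 V2 (st (N + K)) - dual_opt G f xbar
         \<le> ereal \<gamma> * (alg_objective G f V1 V2 (st N) - dual_opt G f xbar))"
proof -
  interpret dual_ascent G f V1 V2 \<sigma>
    by (rule dual_ascent.intro) (use assms in auto)
  interpret graph: pair_fin_digraph G by (rule assms(1))
  obtain u where u: "u \<in> pverts G" using assms(2) by (auto simp: strongly_connected_def)
  obtain C :: real where C: "C \<ge> 0"
    "\<And>(x :: 'v \<Rightarrow> real^'m) \<delta> u v.
       \<lbrakk>\<delta> \<ge> 0; \<forall>(i, j)\<in>parcs G. dist (x i) (x j) \<le> \<delta>; u \<in> pverts G; v \<in> pverts G\<rbrakk>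
       \<Longrightarrow> dist (x u) (x v) \<le> C * \<delta>"
    using consensus_constant[OF assms(1,2)] by blast
  define L where "L = K * card (operations G)"
  define c where "c = contraction_constant s_min L C"
  have c: "c \<ge> 1" unfolding c_def by (rule contraction_constant_ge[OF assms(8)])
  define \<gamma> where "\<gamma> = 1 - 1 / (c + 1)"
  have \<gamma>: "0 < \<gamma>" "\<gamma> < 1" using c by (auto simp: \<gamma>_def field_simps)
  have fin_ops: "finite (operations G)" by (simp add: operations_def)
  show ?thesis
  proof (rule exI[of _ \<gamma>], intro conjI \<gamma> allI impI, elim conjE)
    fix st :: "nat \<Rightarrow> ('v, 'm) state" and ops :: "nat \<Rightarrow> 'v operation list" and N :: nat
    assume run: "algorithm_run G f V1 V2 xbar (N + K) st ops"
      and m1: "\<forall>k\<le>K. (\<Sum>\<alpha>\<in>comps G. s_of (st (N + k)) \<alpha>) = real (card (pverts G)) \<and>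
               (\<forall>i\<in>pverts G. s_of (st (N + k)) (Node i) > 0) \<and>
               (\<forall>e\<in>parcs G. s_of (st (N + k)) (Edge e) \<ge> 0)"
      and m2: "\<forall>k\<le>K. \<forall>\<alpha>\<in>comps G. s_of (st (N + k)) \<alpha> > 0 \<longrightarrow>
               s_min \<le> s_of (st (N + k)) \<alpha> \<and> s_of (st (N + k)) \<alpha> \<le> s_max"
      and sweep: "distinct (ops N)" "set (ops N) = OpC ` pverts G"
      and comm: "\<forall>(i, j)\<in>parcs G. \<exists>kbar\<in>{1..K - 1}.
               followed_by (OpA i) (OpB (i, j)) (ops (N + kbar))"
    have it: "set (ops k) \<subseteq> operations G" "distinct (ops k)"
      "perform_list G f V2 (ops k) (st k) (st (Suc k))" if "k < N + K" for k
      using run that by (auto simp: algorithm_run_def iteration_def)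
    have runN: "perform_list G f V2 (concat (map (\<lambda>k. ops (0 + k)) [0..<N])) (st 0) (st (0 + N))"
      by (rule perform_list_concat) (use it in auto)
    have opsN: "set (concat (map (\<lambda>k. ops (0 + k)) [0..<N])) \<subseteq> operations G"
    proof
      fix x assume "x \<in> set (concat (map (\<lambda>k. ops (0 + k)) [0..<N]))"
      then obtain k where "k < N" "x \<in> set (ops k)" by auto
      then show "x \<in> operations G" using it(1)[of k] by auto
    qed
    have init: "initial_state G f V1 V2 xbar (st 0)"
      using run by (simp add: algorithm_run_def)
    have N: "admissible (st N)" "momentum (st N) = node_count *\<^sub>R mean_vec G xbar"
      using perform_list_invariants[OF initial_state_invariants(1)[OF init] opsN runN]
        initial_state_invariants(2)[OF init] by simp_all
    \<comment> \<open>all operations after the sweep, that is, those of the iterations \<open>N + 1, \<dots>, N + K - 1\<close>\<close>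
    define ps where "ps = concat (map (\<lambda>k. ops (Suc N + k)) [0..<K - 1])"
    have perf: "perform_list G f V2 ps (st (Suc N)) (st (N + K))"
    proof -
      have "perform_list G f V2 ps (st (Suc N)) (st (Suc N + (K - 1)))"
        unfolding ps_def by (rule perform_list_concat) (use it in auto)
      then show ?thesis using assms(10) by simp
    qed
    have ps_ops: "set ps \<subseteq> operations G"
    proof
      fix x assume "x \<in> set ps"
      then obtain k where "k < K - 1" "x \<in> set (ops (Suc N + k))" by (auto simp: ps_def)
      moreover from this have "Suc N + k < N + K" by linarith
      ultimately show "x \<in> operations G" using it(1) by blast
    qed
    have len: "length ps \<le> L"
    proof -
      have "length (ops (Suc N + k)) \<le> card (operations G)" if "k < K - 1" for k
      proof -
        have k: "Suc N + k < N + K" using that by simp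
        show ?thesis
          using card_mono[OF fin_ops it(1)[OF k]] distinct_card[OF it(2)[OF k]] by simp
      qed
      then have "(\<Sum>k<K - 1. length (ops (Suc N + k))) \<le> (\<Sum>k<K - 1. card (operations G))"
        by (intro sum_mono) auto
      also have "\<dots> \<le> L" by (simp add: L_def)
      finally show ?thesis
        by (simp add: ps_def length_concat sum_list_sum_nth atLeast0LessThan)
    qed
    have comm': "\<exists>ps1 ps2. ps = ps1 @ OpA i # ps2 \<and> OpB (i, j) \<in> set ps2" if e: "(i, j) \<in> parcs G" for i j
    proof -
      obtain kbar where kbar: "kbar \<in> {1..K - 1}" "followed_by (OpA i) (OpB (i, j)) (ops (N + kbar))"
        using comm e by blast
      obtain b1 b2 where b: "ops (N + kbar) = b1 @ OpA i # b2" "OpB (i, j) \<in> set b2"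
        by (rule followed_by_split[OF kbar(2)])
      have "kbar - 1 \<in> set [0..<K - 1]" using kbar(1) by auto
      then obtain r1 r2 where "[0..<K - 1] = r1 @ (kbar - 1) # r2" by (meson split_list)
      moreover have "Suc N + (kbar - 1) = N + kbar" using kbar(1) by auto
      ultimately have "ps = (concat (map (\<lambda>k. ops (Suc N + k)) r1) @ b1) @ OpA i # (b2 @ concat (map (\<lambda>k. ops (Suc N + k)) r2))"
        by (simp add: ps_def b(1) del: add_Suc)
      moreover have "OpB (i, j) \<in> set (b2 @ concat (map (\<lambda>k. ops (Suc N + k)) r2))" using b(2) by simp
      ultimately show ?thesis by blast
    qed
    have mass: "mass_at_least s_min (st (N + k))" if k: "k \<le> K" for k
    proof -
      have "s_of (st (N + k)) (Edge e) = 0 \<or> s_min \<le> s_of (st (N + k)) (Edge e)" if "e \<in> parcs G" for e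
      proof -
        have "Edge e \<in> comps G" using that by (simp add: comps_def)
        moreover have "s_of (st (N + k)) (Edge e) \<ge> 0" using m1 k that by blast
        ultimately show ?thesis using m2 k by (metis order_le_less)
      qed
      moreover have "s_min \<le> snode (st (N + k)) i" if "i \<in> pverts G" for i
      proof -
        have "Node i \<in> comps G" using that by (simp add: comps_def)
        moreover have "s_of (st (N + k)) (Node i) > 0" using m1 k that by blast
        ultimately have "s_min \<le> s_of (st (N + k)) (Node i)" using m2 k by blast
        then show ?thesis by simp
      qed
      ultimately show ?thesis by (simp add: mass_at_least_def)
    qed
    have massT: "mass_at_least s_min (st N)" "mass_at_least s_min (st (Suc N))"
      using mass[of 0] mass[of 1] assms(10) by simp_all
    have total: "(\<Sum>\<alpha>\<in>comps G. s_of (st (Suc N)) \<alpha>) = node_count"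
      using m1[rule_format, of 1] assms(10) by (simp add: node_count_def)
    have "perform_list G f V2 (ops N) (st N) (st (Suc N))" using it(3)[of N] assms(10) by simp
    note sw = sweep(2,1) this
    have opt: "dual_opt G f xbar \<noteq> -\<infinity>" by (rule dual_opt_not_MInf[OF N sw total])
    show "objective (st (N + K)) - dual_opt G f xbar
        \<le> ereal \<gamma> * (objective (st N) - dual_opt G f xbar)"
    proof (cases "objective (st N)")
      case (real a0)
      obtain aK where aK: "objective (st (N + K)) = ereal aK" "aK \<le> a0"
        "ereal a0 \<le> dual_opt G f xbar + ereal (c * (a0 - aK))"
        using gap_le_decrease[OF N sw ps_ops perf len comm' massT assms(8) total C u real]
        unfolding c_def by blast
      show ?thesis unfolding real aK(1) \<gamma>_def by (rule contraction_from_gap[OF aK(3) c aK(2)])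
    next
      case PInf
      then have "objective (st N) - dual_opt G f xbar = \<infinity>" using opt by (cases "dual_opt G f xbar") auto
      then show ?thesis using \<gamma> by simp
    next
      case MInf
      with objective_not_MInf[OF N(1)] show ?thesis by simp
    qed
  qed
qed

end
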